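(* Let $p>3$ be an integer relatively prime to $3$. The character variety of the two-bridge link $\mathfrak{b}(2p,3)$, in the coordinates $(x,y,z)=(\mathrm{tr}\,\rho(a),\mathrm{tr}\,\rho(b),\mathrm{tr}\,\rho(ab))$, is the zero set in $\mathbb{C}^3$ of the polynomial $(x^2+y^2+z^2-xyz-4)\,Q_p(x,y,z)$, where $$ Q_p=\begin{cases} (x^2+y^2)S_n(z)S_{n-1}^2(z)-xy\,S_{n-1}(z)\big(S_n^2(z)+S_{n-1}^2(z)\big)+S_{3n}(z) & \text{if } p=3n+1,\\ (x^2+y^2)S_n^2(z)S_{n-1}(z)-xy\,S_n(z)\big(S_n^2(z)+S_{n-1}^2(z)\big)+S_{3n+1}(z) & \text{if } p=3n+2. \end{cases} $$ Moreover, this character variety has exactly two irreducible components.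
   Context: For relatively prime integers $p>m>0$ with $m$ odd, $\mathfrak{b}(2p,m)$ denotes the associated two-bridge link. Its link group is $\pi=\langle a,b\mid aw=wa\rangle$, where $a,b$ are meridians, $w=b^{\varepsilon_1}a^{\varepsilon_2}\cdots a^{\varepsilon_{2p-2}}b^{\varepsilon_{2p-1}}$ (letters alternating $b,a,b,\dots,a,b$) and $\varepsilon_j=(-1)^{\lfloor mj/(2p)\rfloor}$. The character variety of a finitely generated group $G$ is the algebro-geometric quotient of $\mathrm{Hom}(G,SL_2(\mathbb{C}))$ by conjugation; its points are in bijection with the characters of representations $G\to SL_2(\mathbb{C})$. For $G$ generated by two elements $a,b$, a character is determined by $x=\mathrm{tr}\,\rho(a)$, $y=\mathrm{tr}\,\rho(b)$, $z=\mathrm{tr}\,\rho(ab)$, so the character variety is identified with the algebraic subset of $\mathbb{C}^3$ consisting of all such triples $(x,y,z)$, $\rho$ ranging over representations $G\to SL_2(\mathbb{C})$. The character variety of a link is that of its link group. The Chebyshev polynomials $S_k(t)$, $k\in\mathbb{Z}$, are defined by $S_0(t)=1$, $S_1(t)=t$ and $S_{k+1}(t)=tS_k(t)-S_{k-1}(t)$ for all integers $k$. *)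

theory Defs
  imports "HOL-Analysis.Analysis" "HOL-Algebra.Group"
    "HOL-Computational_Algebra.Polynomial"
begin

section \<open>Groups given by generators and relations\<close>

text \<open>
  A word over the alphabet \<open>'g\<close> is a list of letters \<open>(g, e)\<close>, where \<open>(g, True)\<close> stands for
  the generator \<open>g\<close> and \<open>(g, False)\<close> for its formal inverse. A pair \<open>(l, r)\<close> in \<open>R\<close> is the
  relation \<open>l = r\<close>.
\<close>

type_synonym 'g word = "('g \<times> bool) list"

inductive word_equiv :: "('g word \<times> 'g word) set \<Rightarrow> 'g word \<Rightarrow> 'g word \<Rightarrow> bool"
  for R :: "('g word \<times> 'g word) set" where
  refl: "word_equiv R u u"
| sym: "word_equiv R u v \<Longrightarrow> word_equiv R v u"
| trans: "word_equiv R u v \<Longrightarrow> word_equiv R v w \<Longrightarrow> word_equiv R u w"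
| cancel: "word_equiv R (u @ [(g, e), (g, \<not> e)] @ v) (u @ v)"
| relation: "(l, r) \<in> R \<Longrightarrow> word_equiv R (u @ l @ v) (u @ r @ v)"

definition word_class :: "('g word \<times> 'g word) set \<Rightarrow> 'g word \<Rightarrow> 'g word set" where
  "word_class R u = {v. word_equiv R u v}"

text \<open>The group with generating set all of \<open>'g\<close> and with relations \<open>R\<close>.\<close>

definition presented_group :: "('g word \<times> 'g word) set \<Rightarrow> 'g word set monoid" where
  "presented_group R =
     \<lparr>carrier = range (word_class R),
      mult = (\<lambda>X Y. \<Union>u\<in>X. \<Union>v\<in>Y. word_class R (u @ v)),
      one = word_class R []\<rparr>"

lemma word_equiv_context:
  "word_equiv R u v \<Longrightarrow> word_equiv R (s @ u @ t) (s @ v @ t)"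
proof (induction rule: word_equiv.induct)
  case (cancel u g e v)
  show ?case using word_equiv.cancel[of R "s @ u" g e "v @ t"] by simp
next
  case (relation l r u v)
  then show ?case using word_equiv.relation[of l r R "s @ u" "v @ t"] by simp
next
  case (trans u v w)
  show ?case by (rule word_equiv.trans) fact+
qed (simp_all add: word_equiv.refl word_equiv.sym)

lemma word_equiv_append:
  assumes "word_equiv R u u'" "word_equiv R v v'"
  shows "word_equiv R (u @ v) (u' @ v')"
proof (rule word_equiv.trans)
  show "word_equiv R (u @ v) (u' @ v)"
    using word_equiv_context[OF assms(1), of "[]" v] by simp
  show "word_equiv R (u' @ v) (u' @ v')"
    using word_equiv_context[OF assms(2), of u' "[]"] by simp
qed

lemma word_class_eq_iff: "word_class R u = word_class R v \<longleftrightarrow> word_equiv R u v"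
proof
  assume "word_class R u = word_class R v"
  moreover have "v \<in> word_class R v" by (simp add: word_class_def word_equiv.refl)
  ultimately have "v \<in> word_class R u" by simp
  then show "word_equiv R u v" by (simp add: word_class_def)
next
  assume "word_equiv R u v"
  then have "word_equiv R u x \<longleftrightarrow> word_equiv R v x" for x
    by (meson word_equiv.sym word_equiv.trans)
  then show "word_class R u = word_class R v" by (simp add: word_class_def)
qed

lemma presented_group_mult:
  "word_class R u \<otimes>\<^bsub>presented_group R\<^esub> word_class R v = word_class R (u @ v)"
proof -
  have "word_class R (u' @ v') = word_class R (u @ v)"
    if "u' \<in> word_class R u" "v' \<in> word_class R v" for u' v'
  proof -
    have "word_equiv R (u @ v) (u' @ v')"
      using that by (intro word_equiv_append) (simp_all add: word_class_def)
    then show ?thesis by (simp add: word_class_eq_iff word_equiv.sym)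
  qed
  moreover have "u \<in> word_class R u" "v \<in> word_class R v"
    by (simp_all add: word_class_def word_equiv.refl)
  ultimately have "(\<Union>u'\<in>word_class R u. \<Union>v'\<in>word_class R v. word_class R (u' @ v'))
      = word_class R (u @ v)"
    by blast
  then show ?thesis by (simp add: presented_group_def)
qed

lemma word_equiv_inverse:
  "word_equiv R (rev (map (\<lambda>(g, e). (g, \<not> e)) u) @ u) []"
proof (induction u)
  case (Cons x u)
  obtain g e where x: "x = (g, e)" by force
  show ?case
  proof (rule word_equiv.trans[OF _ Cons])
    show "word_equiv R (rev (map (\<lambda>(g, e). (g, \<not> e)) (x # u)) @ x # u)
        (rev (map (\<lambda>(g, e). (g, \<not> e)) u) @ u)"
      using word_equiv.cancel[of R "rev (map (\<lambda>(g, e). (g, \<not> e)) u)" g "\<not> e" u]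
      by (simp add: x)
  qed
qed (simp add: word_equiv.refl)

lemma group_presented_group: "group (presented_group R)"
proof (rule groupI)
  fix X assume "X \<in> carrier (presented_group R)"
  then obtain u where X: "X = word_class R u" by (auto simp: presented_group_def)
  have "word_class R (rev (map (\<lambda>(g, e). (g, \<not> e)) u)) \<otimes>\<^bsub>presented_group R\<^esub> X = word_class R []"
    by (simp add: X presented_group_mult word_class_eq_iff word_equiv_inverse)
  then show "\<exists>Y\<in>carrier (presented_group R). Y \<otimes>\<^bsub>presented_group R\<^esub> X = \<one>\<^bsub>presented_group R\<^esub>"
    by (simp add: presented_group_def) blast
next
  have one: "\<one>\<^bsub>presented_group R\<^esub> = word_class R []" by (simp add: presented_group_def)
  show "\<one>\<^bsub>presented_group R\<^esub> \<in> carrier (presented_group R)" by (simp add: presented_group_def)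
  show "\<one>\<^bsub>presented_group R\<^esub> \<otimes>\<^bsub>presented_group R\<^esub> X = X"
    if "X \<in> carrier (presented_group R)" for X
  proof -
    from that obtain u where "X = word_class R u" by (auto simp: presented_group_def)
    then show ?thesis by (simp add: one presented_group_mult)
  qed
next
  fix X Y assume "X \<in> carrier (presented_group R)" "Y \<in> carrier (presented_group R)"
  then obtain u v where *: "X = word_class R u" "Y = word_class R v"
    by (auto simp: presented_group_def)
  have "X \<otimes>\<^bsub>presented_group R\<^esub> Y = word_class R (u @ v)"
    by (simp add: * presented_group_mult)
  then show "X \<otimes>\<^bsub>presented_group R\<^esub> Y \<in> carrier (presented_group R)"
    by (simp add: presented_group_def)
next
  fix X Y Z
  assume "X \<in> carrier (presented_group R)" "Y \<in> carrier (presented_group R)"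
    "Z \<in> carrier (presented_group R)"
  then obtain u v w where "X = word_class R u" "Y = word_class R v" "Z = word_class R w"
    by (auto simp: presented_group_def)
  then show "X \<otimes>\<^bsub>presented_group R\<^esub> Y \<otimes>\<^bsub>presented_group R\<^esub> Z =
      X \<otimes>\<^bsub>presented_group R\<^esub> (Y \<otimes>\<^bsub>presented_group R\<^esub> Z)"
    by (simp add: presented_group_mult)
qed


section \<open>Two-bridge link groups\<close>

datatype meridian = Mer_a | Mer_b

text \<open>
  The \<open>j\<close>-th letter of \<open>w\<close> (\<open>1 \<le> j \<le> 2p - 1\<close>) is \<open>b\<close> for odd \<open>j\<close> and \<open>a\<close> for even \<open>j\<close>; its
  exponent \<open>(-1)\<close> to the power \<open>\<lfloor>m j / (2 p)\<rfloor>\<close> is \<open>+1\<close> exactly if that floor is even.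
\<close>

definition two_bridge_word :: "nat \<Rightarrow> nat \<Rightarrow> meridian word" where
  "two_bridge_word p m =
     map (\<lambda>j. (if odd j then Mer_b else Mer_a, even (m * j div (2 * p)))) [1..<2 * p]"

definition two_bridge_relations :: "nat \<Rightarrow> nat \<Rightarrow> (meridian word \<times> meridian word) set" where
  "two_bridge_relations p m =
     {([(Mer_a, True)] @ two_bridge_word p m, two_bridge_word p m @ [(Mer_a, True)])}"

definition two_bridge_link_group :: "nat \<Rightarrow> nat \<Rightarrow> meridian word set monoid" where
  "two_bridge_link_group p m = presented_group (two_bridge_relations p m)"

definition link_meridian :: "nat \<Rightarrow> nat \<Rightarrow> meridian \<Rightarrow> meridian word set" where
  "link_meridian p m g = word_class (two_bridge_relations p m) [(g, True)]"


section \<open>Character varieties of two-generator groups\<close>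

definition SL2C :: "(complex^2^2) monoid" where
  "SL2C = \<lparr>carrier = {M. det M = 1}, mult = (**), one = mat 1\<rparr>"

text \<open>
  The \<open>SL\<^sub>2(\<complex>)\<close>-character variety of a group \<open>G\<close> generated by \<open>a\<close> and \<open>b\<close>, in the trace
  coordinates \<open>(tr \<rho>(a), tr \<rho>(b), tr \<rho>(ab))\<close>, which determine the character of \<open>\<rho>\<close>.
\<close>

definition character_variety ::
    "('g, 'more) monoid_scheme \<Rightarrow> 'g \<Rightarrow> 'g \<Rightarrow> (complex \<times> complex \<times> complex) set" where
  "character_variety G a b =
     {(trace (\<rho> a), trace (\<rho> b), trace (\<rho> (a \<otimes>\<^bsub>G\<^esub> b))) | \<rho>. \<rho> \<in> hom G SL2C}"

definition link_character_variety :: "nat \<Rightarrow> nat \<Rightarrow> (complex \<times> complex \<times> complex) set" where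
  "link_character_variety p m =
     character_variety (two_bridge_link_group p m)
       (link_meridian p m Mer_a) (link_meridian p m Mer_b)"


section \<open>Zariski closed subsets of affine three-space\<close>

text \<open>
  \<open>complex poly poly poly\<close> is the polynomial ring \<open>\<complex>[x][y][z]\<close>, with \<open>z\<close> the outermost variable.
\<close>

definition eval3 :: "complex poly poly poly \<Rightarrow> complex \<times> complex \<times> complex \<Rightarrow> complex" where
  "eval3 P = (\<lambda>(x, y, z). poly (poly (poly P [:[:z:]:]) [:y:]) x)"

definition zero_set :: "complex poly poly poly set \<Rightarrow> (complex \<times> complex \<times> complex) set" where
  "zero_set F = {v. \<forall>P\<in>F. eval3 P v = 0}"

definition algebraic_set :: "(complex \<times> complex \<times> complex) set \<Rightarrow> bool" where
  "algebraic_set V \<longleftrightarrow> (\<exists>F. V = zero_set F)"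

definition irreducible_set :: "(complex \<times> complex \<times> complex) set \<Rightarrow> bool" where
  "irreducible_set V \<longleftrightarrow>
     algebraic_set V \<and> V \<noteq> {} \<and>
     (\<forall>V1 V2. algebraic_set V1 \<and> algebraic_set V2 \<and> V = V1 \<union> V2 \<longrightarrow> V = V1 \<or> V = V2)"

definition irreducible_components ::
    "(complex \<times> complex \<times> complex) set \<Rightarrow> (complex \<times> complex \<times> complex) set set" where
  "irreducible_components X =
     {V. irreducible_set V \<and> V \<subseteq> X \<and>
         (\<forall>W. irreducible_set W \<and> V \<subseteq> W \<and> W \<subseteq> X \<longrightarrow> W = V)}"


section \<open>Chebyshev polynomials and the polynomial \<open>Q\<^sub>p\<close>\<close>

fun cheb_S_nat :: "nat \<Rightarrow> 'a::comm_ring_1 \<Rightarrow> 'a" where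
  "cheb_S_nat 0 t = 1"
| "cheb_S_nat (Suc 0) t = t"
| "cheb_S_nat (Suc (Suc k)) t = t * cheb_S_nat (Suc k) t - cheb_S_nat k t"

text \<open>
  Running the recurrence backwards gives \<open>S\<^bsub>-1\<^esub> = 0\<close> and \<open>S\<^bsub>-k\<^esub> = - S\<^bsub>k - 2\<^esub>\<close>; the lemmas
  below are the defining equations of \<open>S\<close> over all integers.
\<close>

definition cheb_S :: "int \<Rightarrow> 'a::comm_ring_1 \<Rightarrow> 'a" where
  "cheb_S k t =
     (if k \<ge> 0 then cheb_S_nat (nat k) t
      else if k = -1 then 0
      else - cheb_S_nat (nat (- k - 2)) t)"

lemma cheb_S_0: "cheb_S 0 t = 1"
  by (simp add: cheb_S_def)

lemma cheb_S_1: "cheb_S 1 t = t"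
  by (simp add: cheb_S_def)

lemma cheb_S_rec: "cheb_S (k + 1) t = t * cheb_S k t - cheb_S (k - 1) t"
proof -
  consider "k \<ge> 1" | "k = 0" | "k = -1" | "k = -2" | "k \<le> -3" by linarith
  then show ?thesis
  proof cases
    case 1
    then have "nat (k + 1) = Suc (Suc (nat (k - 1)))" "nat k = Suc (nat (k - 1))" by auto
    with 1 show ?thesis by (simp add: cheb_S_def)
  next
    case 5
    then have "nat (- (k - 1) - 2) = Suc (Suc (nat (- (k + 1) - 2)))"
      "nat (- k - 2) = Suc (nat (- (k + 1) - 2))" by auto
    with 5 show ?thesis by (simp add: cheb_S_def)
  qed (simp_all add: cheb_S_def)
qed

definition Q_poly :: "nat \<Rightarrow> complex \<Rightarrow> complex \<Rightarrow> complex \<Rightarrow> complex" where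
  "Q_poly p x y z =
     (let n = int (p div 3) in
      if p mod 3 = 1 then
        (x\<^sup>2 + y\<^sup>2) * cheb_S n z * (cheb_S (n - 1) z)\<^sup>2
        - x * y * cheb_S (n - 1) z * ((cheb_S n z)\<^sup>2 + (cheb_S (n - 1) z)\<^sup>2)
        + cheb_S (3 * n) z
      else
        (x\<^sup>2 + y\<^sup>2) * (cheb_S n z)\<^sup>2 * cheb_S (n - 1) z
        - x * y * cheb_S n z * ((cheb_S n z)\<^sup>2 + (cheb_S (n - 1) z)\<^sup>2)
        + cheb_S (3 * n + 1) z)"

end

theory Submission
  imports Defs
begin

text \<open>
  Put \<open>A = \<rho>(a)\<close>, \<open>B = \<rho>(b)\<close>. By Cayley-Hamilton every word in \<open>A\<close>, \<open>B\<close> is a combination of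
  \<open>1, A, B, AB\<close> with coefficients in \<open>\<complex>[x, y, z]\<close>. For \<open>w\<close>, a product of powers of \<open>ab\<close>, \<open>ba\<close> and
  their inverses, these come out as \<open>W = c\<^sub>0 + c\<^sub>1 A - Q\<^sub>p B\<close> (\<open>w\<close> is a palindrome, so \<open>AB\<close> does not
  occur). Hence \<open>AW - WA = - Q\<^sub>p (AB - BA)\<close>, and the relation holds iff \<open>Q\<^sub>p = 0\<close> or \<open>A\<close> and \<open>B\<close>
  commute; traces of commuting pairs fill the cubic \<open>x\<^sup>2 + y\<^sup>2 + z\<^sup>2 - xyz - 4 = 0\<close>.

  The cubic is parametrized by \<open>(u, v) \<mapsto> (u + 1/u, v + 1/v, uv + 1/(uv))\<close>, so it is irreducible.
  The quadratic part of \<open>Q\<^sub>p\<close> splits: with \<open>s = S\<^sub>n(z)\<close>, \<open>r = S\<close>\<open>\<^bsub>n-1\<^esub>(z)\<close> one has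
  \<open>Q\<^sub>p = c (sx - ry)(rx - sy) + S\<close>\<open>\<^bsub>p-1\<^esub>(z)\<close> where \<open>c = r\<close> or \<open>c = s\<close>. Over generic \<open>z\<close> the coordinate
  \<open>u = sx - ry\<close> therefore parametrizes the conic \<open>Q\<^sub>p = 0\<close> rationally, and no component is contained
  in a special fibre, so \<open>Q\<^sub>p = 0\<close> is irreducible as well.
\<close>

section \<open>Chebyshev polynomials\<close>

text \<open>The form \<open>s^2 + r^2 - t s r\<close> is invariant under the recurrence step
  \<open>(s, r) -> (t s - r, s)\<close>. In particular two consecutive values never vanish
  together.\<close>

lemma cheb_S_consecutive:
  "(cheb_S k t)\<^sup>2 + (cheb_S (k - 1) t)\<^sup>2 - t * cheb_S k t * cheb_S (k - 1) t = (1::'a::idom)"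
proof (induction k rule: int_induct[where k = 0])
  case base
  then show ?case by (simp add: cheb_S_def)
next
  case (step1 i)
  have "cheb_S (i + 1) t = t * cheb_S i t - cheb_S (i - 1) t" by (rule cheb_S_rec)
  with step1(2) show ?case by simp algebra
next
  case (step2 i)
  have "cheb_S i t = t * cheb_S (i - 1) t - cheb_S (i - 1 - 1) t"
    using cheb_S_rec[of "i - 1" t] by simp
  with step2(2) show ?case by algebra
qed

lemma cheb_S_minus1: "cheb_S (-1) t = 0"
  by (simp add: cheb_S_def)

lemma cheb_S_diff2: "cheb_S (k - 2) t = t * cheb_S (k - 1) t - cheb_S k t"
  using cheb_S_rec[of "k - 1" t] by simp

text \<open>The two conjuncts are carried through the induction together because the recurrence has
  order two.\<close>

lemma cheb_S_add_nat:
  "cheb_S (k + int m) t = cheb_S k t * cheb_S (int m) t - cheb_S (k - 1) t * cheb_S (int m - 1) (t::'a::idom)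
   \<and> cheb_S (k + int m + 1) t = cheb_S k t * cheb_S (int m + 1) t - cheb_S (k - 1) t * cheb_S (int m) t"
proof (induction m)
  case 0
  then show ?case by (simp add: cheb_S_0 cheb_S_minus1 cheb_S_1 cheb_S_rec mult.commute)
next
  case (Suc m)
  have 1: "cheb_S (k + int m + 2) t = t * cheb_S (k + int m + 1) t - cheb_S (k + int m) t"
    using cheb_S_rec[of "k + int m + 1" t] by (simp add: add.assoc)
  have 2: "cheb_S (int m + 2) t = t * cheb_S (int m + 1) t - cheb_S (int m) t"
    using cheb_S_rec[of "int m + 1" t] by (simp add: add.assoc)
  have 3: "cheb_S (int m + 1) t = t * cheb_S (int m) t - cheb_S (int m - 1) t"
    by (rule cheb_S_rec)
  have 5: "cheb_S (k + int m + 2) t = cheb_S k t * cheb_S (int m + 2) t - cheb_S (k - 1) t * cheb_S (int m + 1) t"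
    using Suc 1 2 3 by algebra
  show ?case using conjunct2[OF Suc] 5 by (simp add: ac_simps)
qed

text \<open>The addition formula is applied to \<open>k + k\<close> and then to
  \<open>2 * k + k\<close>; the neighbouring values at \<open>k + 1\<close> and \<open>k - 2\<close>
  are eliminated by the recurrence.\<close>

lemma cheb_S_triple:
  fixes n :: nat and z :: "'a::idom"
  defines "s \<equiv> cheb_S (int n) z" and "r \<equiv> cheb_S (int n - 1) z"
  shows "cheb_S (3 * int n) z = s ^ 3 - 3 * s * r\<^sup>2 + z * r ^ 3"
    and "cheb_S (3 * int n + 1) z = z * s ^ 3 - 3 * s\<^sup>2 * r + r ^ 3"
proof -
  define k where "k = int n"
  have q: "cheb_S (k - 2) z = z * r - s" unfolding r_def s_def k_def by (rule cheb_S_diff2)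
  have sp: "cheb_S (k + 1) z = z * s - r" unfolding r_def s_def k_def by (rule cheb_S_rec)
  have a: "cheb_S (k + k) z = s * s - r * r" "cheb_S (k + k + 1) z = s * (z * s - r) - r * s"
    using cheb_S_add_nat[of k n z] unfolding k_def[symmetric]
    by (simp_all add: k_def r_def s_def sp[unfolded k_def s_def r_def])
  have b: "cheb_S (k + k - 1) z = s * r - r * (z * r - s)"
    using cheb_S_add_nat[of "k - 1" n z] q by (simp add: k_def r_def s_def add.commute)
  have c: "cheb_S (2 * k + k) z = (s * s - r * r) * s - (s * r - r * (z * r - s)) * r"
     "cheb_S (2 * k + k + 1) z = (s * s - r * r) * (z * s - r) - (s * r - r * (z * r - s)) * s"
    using cheb_S_add_nat[of "k + k" n z] unfolding k_def[symmetric] a b sp by (simp_all add: k_def r_def s_def)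
  show "cheb_S (3 * int n) z = s ^ 3 - 3 * s * r\<^sup>2 + z * r ^ 3"
    using c(1) by (simp add: k_def algebra_simps power3_eq_cube power2_eq_square)
  show "cheb_S (3 * int n + 1) z = z * s ^ 3 - 3 * s\<^sup>2 * r + r ^ 3"
    using c(2) by (simp add: k_def algebra_simps power3_eq_cube power2_eq_square)
qed

lemma poly_cheb_S: "poly (cheb_S k p) z = cheb_S k (poly p z)"
proof -
  have "poly (cheb_S_nat n p) z = cheb_S_nat n (poly p z)" for n
    by (induction n p rule: cheb_S_nat.induct) simp_all
  then show ?thesis by (simp add: cheb_S_def)
qed

text \<open>At 2 the recurrence produces an arithmetic progression. This supplies a point where
  \<open>S_k\<close> with \<open>k \<ge> 0\<close> is visibly nonzero.\<close>

lemma cheb_S_2: "cheb_S k 2 = of_int (k + 1)" if "k \<ge> 0" for k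
proof -
  have "cheb_S_nat n (2::'a::comm_ring_1) = of_nat n + 1" for n
    by (induction n "2::'a" rule: cheb_S_nat.induct) (simp_all add: algebra_simps)
  from this[of "nat k"] that show ?thesis by (simp add: cheb_S_def)
qed

text \<open>The classical formula for Chebyshev polynomials of the second kind, stated without
  division. It later yields an explicit zero of \<open>S_{p-1}\<close>.\<close>

lemma cheb_S_cos:
  "cheb_S (int k) (complex_of_real (2 * cos \<theta>)) * complex_of_real (sin \<theta>) = complex_of_real (sin (real (k + 1) * \<theta>))"
proof (induction k rule: induct_nat_012)
  case 0
  then show ?case by (simp add: cheb_S_0)
next
  case 1
  have "sin (real (Suc 0 + 1) * \<theta>) = 2 * sin \<theta> * cos \<theta>"
    using sin_double[of \<theta>] by simp
  then show ?case by (simp add: cheb_S_1)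
next
  case (ge2 k)
  have "cheb_S (int (Suc (Suc k))) (complex_of_real (2 * cos \<theta>)) =
      complex_of_real (2 * cos \<theta>) * cheb_S (int (Suc k)) (complex_of_real (2 * cos \<theta>)) - cheb_S (int k) (complex_of_real (2 * cos \<theta>))"
    using cheb_S_rec[of "int (Suc k)"] by (simp add: add.commute)
  then have "cheb_S (int (Suc (Suc k))) (complex_of_real (2 * cos \<theta>)) * complex_of_real (sin \<theta>) =
      complex_of_real (2 * cos \<theta>) * complex_of_real (sin (real (Suc k + 1) * \<theta>)) - complex_of_real (sin (real (k + 1) * \<theta>))"
    unfolding ge2.IH[symmetric] by (simp only: left_diff_distrib mult.assoc)
  also have "\<dots> = complex_of_real (2 * cos \<theta> * sin (real (Suc k + 1) * \<theta>) - sin (real (k + 1) * \<theta>))"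
    by simp
  also have "2 * cos \<theta> * sin (real (Suc k + 1) * \<theta>) - sin (real (k + 1) * \<theta>) = sin (real (Suc (Suc k) + 1) * \<theta>)"
  proof -
    define \<alpha> where "\<alpha> = real (Suc k + 1) * \<theta>"
    have "real (k + 1) * \<theta> = \<alpha> - \<theta>" "real (Suc (Suc k) + 1) * \<theta> = \<alpha> + \<theta>"
      by (simp_all add: \<alpha>_def algebra_simps)
    then show ?thesis unfolding \<alpha>_def[symmetric] by (simp add: sin_add sin_diff)
  qed
  finally show ?case .
qed

section \<open>Words in a pair of unimodular matrices\<close>

text \<open>Entrywise, so that identities between combinations with complex coefficients become ring
  identities in the matrix entries.\<close>

definition comb :: "complex^2^2 \<Rightarrow> complex^2^2 \<Rightarrow> complex \<Rightarrow> complex \<Rightarrow> complex \<Rightarrow> complex \<Rightarrow> complex^2^2" where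
  "comb A B c0 c1 c2 c3 =
     (\<chi> i j. c0 * mat 1 $ i $ j + c1 * A $ i $ j + c2 * B $ i $ j + c3 * (A ** B) $ i $ j)"

lemma matrix_mul_2: "(M ** N) $ i $ j = M $ i $ 1 * N $ 1 $ j + M $ i $ (2::2) * N $ 2 $ j"
  for M N :: "'a::semiring_1^2^2"
  by (simp add: matrix_matrix_mult_def sum_2)

lemma trace_2: "trace M = M $ 1 $ 1 + M $ 2 $ (2::2)"
  by (simp add: trace_def sum_2)

text \<open>These are the structure constants that follow from \<open>A^2 = x A - 1\<close>,
  \<open>B^2 = y B - 1\<close> and \<open>B A = (z - x y) + y A + x B - A B\<close>. The proof
  checks the four entries modulo the two determinant equations.\<close>

lemma comb_mult:
  assumes "det A = 1" "det B = 1"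
  defines "x \<equiv> trace A" and "y \<equiv> trace B" and "z \<equiv> trace (A ** B)"
  shows "comb A B c0 c1 c2 c3 ** comb A B d0 d1 d2 d3 = comb A B
    (c0 * d0 - c1 * d1 + c2 * d1 * (z - x * y) - c2 * d2 - c2 * d3 * x - c3 * d1 * y - c3 * d3)
    (c0 * d1 + c1 * d0 + c1 * d1 * x + c2 * d1 * y + c2 * d3 + c3 * d1 * z - c3 * d2)
    (c0 * d2 + c2 * d0 - c1 * d3 + c2 * d1 * x + c2 * d2 * y + c2 * d3 * z + c3 * d1)
    (c0 * d3 + c3 * d0 + c1 * d2 + c1 * d3 * x - c2 * d1 + c3 * d2 * y + c3 * d3 * z)"
proof -
  obtain a11 a12 a21 a22 where a: "A $ 1 $ 1 = a11" "A $ 1 $ 2 = a12" "A $ 2 $ 1 = a21" "A $ 2 $ 2 = a22" by simp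
  obtain b11 b12 b21 b22 where b: "B $ 1 $ 1 = b11" "B $ 1 $ 2 = b12" "B $ 2 $ 1 = b21" "B $ 2 $ 2 = b22" by simp
  have d: "a11 * a22 - a12 * a21 = 1" "b11 * b22 - b12 * b21 = 1"
    using assms(1,2) by (simp_all add: det_2 a b)
  show ?thesis
    unfolding vec_eq_iff forall_2 x_def y_def z_def
    apply (simp only: matrix_mul_2 comb_def trace_2 vec_lambda_beta mat_def a b if_True if_False 
       one_neq_zero zero_neq_one simp_thms exhaust_2)
    apply (intro conjI)
    apply (simp; insert d; algebra)
    apply (simp; insert d; algebra)
    apply (simp; insert d; algebra)
    apply (simp; insert d; algebra)
    done
qed

section \<open>Inverses, evaluation of words, and matrix powers\<close>

definition adj2 :: "complex^2^2 \<Rightarrow> complex^2^2" where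
  "adj2 M = (\<chi> i j. trace M * mat 1 $ i $ j - M $ i $ j)"

text \<open>Cayley-Hamilton in the form \<open>M (tr M - M) = det M\<close>. The inverse is thus a
  linear combination of \<open>1\<close> and \<open>M\<close>.\<close>

lemma adj2_inverse:
  assumes "det M = 1"
  shows "M ** adj2 M = mat 1" "adj2 M ** M = mat 1"
  using assms
  by (simp_all add: vec_eq_iff forall_2 matrix_mul_2 adj2_def trace_2 mat_def det_2 algebra_simps)

lemma det_adj2: "det (adj2 M) = det M"
  by (simp add: adj2_def det_2 trace_2 mat_def)

definition letter_eval :: "complex^2^2 \<Rightarrow> complex^2^2 \<Rightarrow> meridian \<times> bool \<Rightarrow> complex^2^2" where
  "letter_eval A B l =
     (if snd l then (case fst l of Mer_a \<Rightarrow> A | Mer_b \<Rightarrow> B)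
      else adj2 (case fst l of Mer_a \<Rightarrow> A | Mer_b \<Rightarrow> B))"

definition word_eval :: "complex^2^2 \<Rightarrow> complex^2^2 \<Rightarrow> meridian word \<Rightarrow> complex^2^2" where
  "word_eval A B u = foldr (\<lambda>l M. letter_eval A B l ** M) u (mat 1)"

lemma word_eval_Nil [simp]: "word_eval A B [] = mat 1"
  by (simp add: word_eval_def)

lemma word_eval_Cons [simp]: "word_eval A B (l # u) = letter_eval A B l ** word_eval A B u"
  by (simp add: word_eval_def)

lemma word_eval_append [simp]: "word_eval A B (u @ v) = word_eval A B u ** word_eval A B v"
  by (induction u) (simp_all add: matrix_mul_assoc)

lemma det_word_eval: "det A = 1 \<Longrightarrow> det B = 1 \<Longrightarrow> det (word_eval A B u) = 1"
  by (induction u) (auto simp: det_mul letter_eval_def det_adj2 split: meridian.split)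

primrec mpow :: "complex^2^2 \<Rightarrow> nat \<Rightarrow> complex^2^2" where
  "mpow M 0 = mat 1"
| "mpow M (Suc k) = mpow M k ** M"

text \<open>Since \<open>M^2 = tr(M) M - 1\<close>, powers of \<open>M\<close> obey the Chebyshev
  recurrence. At \<open>k = 0\<close> the values \<open>S_{-1} = 0\<close> and
  \<open>S_{-2} = -1\<close> give the identity matrix.\<close>

lemma mpow_cheb_S:
  assumes "det M = 1"
  shows "mpow M k = (\<chi> i j. cheb_S (int k - 1) (trace M) * M $ i $ j
                            - cheb_S (int k - 2) (trace M) * mat 1 $ i $ j)"
proof (induction k)
  case 0
  then show ?case by (simp add: vec_eq_iff cheb_S_def)
next
  case (Suc k)
  obtain a11 a12 a21 a22 where a: "M $ 1 $ 1 = a11" "M $ 1 $ 2 = a12" "M $ 2 $ 1 = a21" "M $ 2 $ 2 = a22" by simp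
  have d: "a11 * a22 - a12 * a21 = 1"
    using assms by (simp add: det_2 a)
  define r where "r = cheb_S (int k - 1) (trace M)"
  define q where "q = cheb_S (int k - 2) (trace M)"
  have "cheb_S (int k - 2) (trace M) = trace M * cheb_S (int k - 1) (trace M) - cheb_S (int k) (trace M)"
    by (rule cheb_S_diff2)
  then have t: "cheb_S (int k) (trace M) = (a11 + a22) * r - q"
    by (simp add: r_def q_def trace_2 a)
  have "(r * a11 - q) * a11 + r * a12 * a21 = ((a11 + a22) * r - q) * a11 - r"
    "(r * a11 - q) * a12 + r * a12 * a22 = ((a11 + a22) * r - q) * a12"
    "r * a21 * a11 + (r * a22 - q) * a21 = ((a11 + a22) * r - q) * a21"
    "r * a21 * a12 + (r * a22 - q) * a22 = ((a11 + a22) * r - q) * a22 - r"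
    using d by algebra+
  then show ?case
    by (simp add: Suc t r_def[symmetric] q_def[symmetric]
        vec_eq_iff forall_2 matrix_mul_2 mat_def a)
qed

text \<open>This turns a stretch of equal exponents in the two-bridge word, up to a possible odd
  last letter, into a power of a two-letter product.\<close>

lemma word_eval_alternating:
  assumes "\<And>j. j < 2 * k \<Longrightarrow> f (i + j) = (if even j then u else v)"
  shows "word_eval A B (map f [i..<i + 2 * k]) = mpow (letter_eval A B u ** letter_eval A B v) k"
  using assms
proof (induction k)
  case (Suc k)
  have e: "[i..<i + 2 * Suc k] = [i..<i + 2 * k] @ [i + 2 * k, i + (2 * k + 1)]"
    by simp
  have "f (i + 2 * k) = u" "f (i + (2 * k + 1)) = v"
    using Suc.prems[of "2 * k"] Suc.prems[of "2 * k + 1"] by auto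
  with Suc show ?case unfolding e by (simp add: matrix_mul_assoc)
qed simp

lemma mpow_comb:
  fixes n :: nat
  assumes "det (comb A B m0 m1 m2 m3) = 1" "trace (comb A B m0 m1 m2 m3) = z"
  defines "r \<equiv> cheb_S (int n - 1) z" and "q \<equiv> cheb_S (int n - 2) z"
  shows "mpow (comb A B m0 m1 m2 m3) n = comb A B (r * m0 - q) (r * m1) (r * m2) (r * m3)"
  unfolding mpow_cheb_S[OF assms(1)] assms(2) r_def q_def
  by (simp add: comb_def vec_eq_iff algebra_simps)

section \<open>Calculus in the span of \<open>1\<close>, \<open>A\<close>, \<open>B\<close> and
  \<open>A ** B\<close> for a fixed pair\<close>

locale SL2_pair =
  fixes A B :: "complex^2^2" and x y z :: complex
  assumes det_A: "det A = 1" and det_B: "det B = 1"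
    and x_def: "x = trace A" and y_def: "y = trace B" and z_def: "z = trace (A ** B)"
begin

lemmas mult_comb = comb_mult[OF det_A det_B, folded x_def y_def z_def]

lemma comb_generators:
  "A = comb A B 0 1 0 0" "B = comb A B 0 0 1 0" "adj2 A = comb A B x (-1) 0 0"
  "adj2 B = comb A B y 0 (-1) 0" "A ** B = comb A B 0 0 0 1"
  by (simp_all add: comb_def vec_eq_iff adj2_def x_def y_def)

lemma comb_products:
  "B ** A = comb A B (z - x * y) y x (-1)"
  "adj2 A ** adj2 B = comb A B (x * y) (-y) (-x) 1"
  "adj2 B ** adj2 A = comb A B z 0 0 (-1)"
proof -
  have "comb A B 0 0 1 0 ** comb A B 0 1 0 0 = comb A B (z - x * y) y x (-1)"
    unfolding mult_comb by simp
  then show "B ** A = comb A B (z - x * y) y x (-1)" by (simp flip: comb_generators)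
  have "comb A B x (-1) 0 0 ** comb A B y 0 (-1) 0 = comb A B (x * y) (-y) (-x) 1"
    unfolding mult_comb by simp
  then show "adj2 A ** adj2 B = comb A B (x * y) (-y) (-x) 1" by (simp flip: comb_generators)
  have "comb A B y 0 (-1) 0 ** comb A B x (-1) 0 0 = comb A B z 0 0 (-1)"
    unfolding mult_comb by simp
  then show "adj2 B ** adj2 A = comb A B z 0 0 (-1)" by (simp flip: comb_generators)
qed

text \<open>All four two-letter products have determinant 1 and trace \<open>z\<close>, so the same
  \<open>s\<close> and \<open>r\<close> serve every block of the word.\<close>

lemma mpow_products:
  fixes n :: nat
  defines "r \<equiv> cheb_S (int n - 1) z" and "s \<equiv> cheb_S (int n) z"
  shows "mpow (A ** B) n = comb A B (s - r * z) 0 0 r"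
    and "mpow (B ** A) n = comb A B (s - r * x * y) (r * y) (r * x) (-r)"
    and "mpow (adj2 A ** adj2 B) n = comb A B (r * x * y - (z * r - s)) (- (r * y)) (- (r * x)) r"
    and "mpow (adj2 B ** adj2 A) n = comb A B s 0 0 (-r)"
proof -
  have q: "cheb_S (int n - 2) z = z * r - s"
    unfolding r_def s_def by (rule cheb_S_diff2)
  have dets: "det (A ** B) = 1" "det (B ** A) = 1" "det (adj2 A ** adj2 B) = 1" "det (adj2 B ** adj2 A) = 1"
    by (simp_all add: det_mul det_adj2 det_A det_B)
  have traces: "trace (A ** B) = z" "trace (B ** A) = z" "trace (adj2 A ** adj2 B) = z" "trace (adj2 B ** adj2 A) = z"
    by (simp_all add: z_def trace_2 matrix_mul_2 adj2_def mat_def algebra_simps)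
  show "mpow (A ** B) n = comb A B (s - r * z) 0 0 r"
    using mpow_comb[of A B 0 0 0 1 z n] dets(1) traces(1) unfolding comb_generators(5) q
    by (simp add: r_def[symmetric] mult.commute)
  show "mpow (B ** A) n = comb A B (s - r * x * y) (r * y) (r * x) (-r)"
    using mpow_comb[of A B "z - x * y" y x "-1" z n] dets(2) traces(2) unfolding comb_products q
    by (simp add: r_def[symmetric] algebra_simps)
  show "mpow (adj2 A ** adj2 B) n = comb A B (r * x * y - (z * r - s)) (- (r * y)) (- (r * x)) r"
    using mpow_comb[of A B "x * y" "-y" "-x" "1" z n] dets(3) traces(3) unfolding comb_products q
    by (simp add: r_def[symmetric] algebra_simps)
  show "mpow (adj2 B ** adj2 A) n = comb A B s 0 0 (-r)"
    using mpow_comb[of A B z 0 0 "-1" z n] dets(4) traces(4) unfolding comb_products q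
    by (simp add: r_def[symmetric] algebra_simps)
qed

text \<open>The terms in \<open>1\<close> and \<open>A\<close> commute with \<open>A\<close>, so the
  commutator is \<open>c2 (AB - BA)\<close>.\<close>

lemma comb_commute_iff:
  "A ** comb A B c0 c1 c2 0 = comb A B c0 c1 c2 0 ** A \<longleftrightarrow> c2 = 0 \<or> A ** B = B ** A"
proof -
  have "(A ** comb A B c0 c1 c2 0) $ i $ j - (comb A B c0 c1 c2 0 ** A) $ i $ j =
      c2 * ((A ** B) $ i $ j - (B ** A) $ i $ j)" for i j
    using exhaust_2[of i] exhaust_2[of j]
    by (auto simp: matrix_mul_2 comb_def mat_def algebra_simps)
  then show ?thesis by (auto simp: vec_eq_iff)
qed

end

lemma upt_append: "i \<le> j \<Longrightarrow> j \<le> k \<Longrightarrow> [i..<j] @ [j..<k] = [i..<k]"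
  using upt_add_eq_append[of i j "k - j"] by simp

lemma comb_cong:
  "c0 = d0 \<Longrightarrow> c1 = d1 \<Longrightarrow> c2 = d2 \<Longrightarrow> c3 = d3 \<Longrightarrow> comb A B c0 c1 c2 c3 = comb A B d0 d1 d2 d3"
  by simp

text \<open>Used as a rule, this leaves only the coefficients of \<open>B\<close> and
  \<open>A ** B\<close> to be compared.\<close>

lemma ex_comb:
  "c2 = d2 \<Longrightarrow> c3 = d3 \<Longrightarrow> \<exists>d0 d1. comb A B c0 c1 c2 c3 = comb A B d0 d1 d2 d3"
  by blast

section \<open>The two-bridge words for \<open>m = 3\<close>\<close>

context SL2_pair
begin



text \<open>Here \<open>2p = 6n + 2\<close>, and the floor is 0 up to position \<open>2n\<close>, 1
  up to \<open>4n + 1\<close>, and 2 up to \<open>6n + 1\<close>. Hence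
  \<open>w = (ba)^n (b^-1 a^-1)^n b^-1 (ab)^n\<close>.\<close>

lemma word_eval_two_bridge_1:
  fixes n :: nat
  assumes p: "p = 3 * n + 1"
  shows "\<exists>c0 c1. word_eval A B (two_bridge_word p 3) = comb A B c0 c1 (- Q_poly p x y z) 0"
proof -
  define f where "f = (\<lambda>j. (if odd j then Mer_b else Mer_a, even (3 * j div (2 * p))))"
  have d0: "3 * (1 + j) div (2 * p) = 0" if "j < 2 * n" for j
    using that p by (intro div_nat_eqI) auto
  have d1: "3 * (2 * n + 1 + j) div (2 * p) = 1" if "j \<le> 2 * n" for j
    using that p by (intro div_nat_eqI) auto
  have d2: "3 * (4 * n + 2 + j) div (2 * p) = 2" if "j < 2 * n" for j
    using that p by (intro div_nat_eqI) auto
  have f0: "f (1 + j) = (if even j then (Mer_b, True) else (Mer_a, True))" if "j < 2 * n" for j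
    unfolding f_def d0[OF that] by simp
  have f1: "f (2 * n + 1 + j) = (if even j then (Mer_b, False) else (Mer_a, False))" if "j \<le> 2 * n" for j
    unfolding f_def d1[OF that] by simp
  have f2: "f (4 * n + 2 + j) = (if even j then (Mer_a, True) else (Mer_b, True))" if "j < 2 * n" for j
    unfolding f_def d2[OF that] by simp
  \<comment> \<open>The middle stretch has odd length, so its last letter is split off.\<close>
  have "[4 * n + 1] = [2 * n + 1 + 2 * n..<4 * n + 2]"
    by simp
  then have e: "[1..<2 * p] = [1..<1 + 2 * n] @ [2 * n + 1..<2 * n + 1 + 2 * n] @ [4 * n + 1]
      @ [4 * n + 2..<4 * n + 2 + 2 * n]"
    by (simp add: p upt_append add.commute del: upt_Suc)
  have "word_eval A B (two_bridge_word p 3) =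
      mpow (B ** A) n ** (mpow (adj2 B ** adj2 A) n ** (adj2 B ** mpow (A ** B) n))"
    unfolding two_bridge_word_def f_def[symmetric] e map_append word_eval_append
    using word_eval_alternating[where k = n and f = f and i = 1, OF f0]
      word_eval_alternating[where k = n and f = f and i = "2 * n + 1", OF f1[OF less_imp_le]]
      word_eval_alternating[where k = n and f = f and i = "4 * n + 2", OF f2]
      f1[of "2 * n"]
    by (simp add: letter_eval_def)
  moreover define r s where "r = cheb_S (int n - 1) z" and "s = cheb_S (int n) z"
  ultimately have W: "word_eval A B (two_bridge_word p 3) =
      comb A B (s - r * x * y) (r * y) (r * x) (-r) **
       (comb A B s 0 0 (-r) ** (comb A B y 0 (-1) 0 ** comb A B (s - r * z) 0 0 r))"
    by (simp add: mpow_products comb_generators(4)[symmetric])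
  have rel: "s\<^sup>2 + r\<^sup>2 - z * s * r = 1"
    unfolding s_def r_def by (rule cheb_S_consecutive)
  have dm: "p div 3 = n" "p mod 3 = 1"
    using p by presburger+
  have Q: "Q_poly p x y z = (x\<^sup>2 + y\<^sup>2) * s * r\<^sup>2 - x * y * r * (s\<^sup>2 + r\<^sup>2) + (s ^ 3 - 3 * s * r\<^sup>2 + z * r ^ 3)"
    unfolding Q_poly_def Let_def dm s_def r_def cheb_S_triple(1)[symmetric] by simp
  have V: "comb A B y 0 (-1) 0 ** comb A B (s - r * z) 0 0 r =
      comb A B (y * (s - r * z) + r * x) (-r) (-s) (r * y)"
    unfolding mult_comb by (simp add: algebra_simps)
  \<comment> \<open>The relation \<open>rel\<close> removes \<open>z\<close> from this coefficient
    before the last product is formed.\<close>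
  have "s * (y * (s - r * z) + r * x) = y * (1 - r\<^sup>2) + s * r * x"
  proof -
    have "s * (y * (s - r * z) + r * x) = y * (s\<^sup>2 - z * s * r) + s * r * x"
      by (simp add: algebra_simps power2_eq_square)
    also have "s\<^sup>2 - z * s * r = 1 - r\<^sup>2"
      using rel by (simp add: algebra_simps)
    finally show ?thesis .
  qed
  then have U: "comb A B s 0 0 (-r) ** comb A B (y * (s - r * z) + r * x) (-r) (-s) (r * y) =
      comb A B (y * (1 - r\<^sup>2) + s * r * x) (r\<^sup>2 * z - 2 * r * s) (r\<^sup>2 - s\<^sup>2) (r * s * y - r\<^sup>2 * x)"
    unfolding mult_comb by (intro comb_cong) (simp_all add: algebra_simps power2_eq_square)
  \<comment> \<open>Two goals remain: the coefficient of \<open>B\<close> is \<open>- Q_p\<close>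
    and that of \<open>A ** B\<close> is 0. Both hold modulo \<open>rel\<close>.\<close>
  show ?thesis
    unfolding W V U unfolding mult_comb
    apply (rule ex_comb)
     apply (unfold Q)
     apply (insert rel, simp, algebra)
    apply (insert rel, simp, algebra)
    done
qed

text \<open>Here \<open>2p = 6n + 4\<close>, and each value of the floor occupies
  \<open>2n + 1\<close> positions. Hence
  \<open>w = (ba)^n b (a^-1 b^-1)^n a^-1 (ba)^n b\<close>.\<close>

lemma word_eval_two_bridge_2:
  fixes n :: nat
  assumes p: "p = 3 * n + 2"
  shows "\<exists>c0 c1. word_eval A B (two_bridge_word p 3) = comb A B c0 c1 (- Q_poly p x y z) 0"
proof -
  define f where "f = (\<lambda>j. (if odd j then Mer_b else Mer_a, even (3 * j div (2 * p))))"
  have d0: "3 * (1 + j) div (2 * p) = 0" if "j \<le> 2 * n" for j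
    using that p by (intro div_nat_eqI) auto
  have d1: "3 * (2 * n + 2 + j) div (2 * p) = 1" if "j \<le> 2 * n" for j
    using that p by (intro div_nat_eqI) auto
  have d2: "3 * (4 * n + 3 + j) div (2 * p) = 2" if "j \<le> 2 * n" for j
    using that p by (intro div_nat_eqI) auto
  have f0: "f (1 + j) = (if even j then (Mer_b, True) else (Mer_a, True))" if "j \<le> 2 * n" for j
    unfolding f_def d0[OF that] by simp
  have f1: "f (2 * n + 2 + j) = (if even j then (Mer_a, False) else (Mer_b, False))" if "j \<le> 2 * n" for j
    unfolding f_def d1[OF that] by simp
  have f2: "f (4 * n + 3 + j) = (if even j then (Mer_b, True) else (Mer_a, True))" if "j \<le> 2 * n" for j
    unfolding f_def d2[OF that] by simp
  have "[1 + 2 * n] = [1 + 2 * n..<2 * n + 2]" "[2 * n + 2 + 2 * n] = [2 * n + 2 + 2 * n..<4 * n + 3]"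
      "[4 * n + 3 + 2 * n] = [4 * n + 3 + 2 * n..<2 * p]"
    by (simp_all add: p upt_rec)
  then have e: "[1..<2 * p] = [1..<1 + 2 * n] @ [1 + 2 * n] @ [2 * n + 2..<2 * n + 2 + 2 * n] @ [2 * n + 2 + 2 * n]
      @ [4 * n + 3..<4 * n + 3 + 2 * n] @ [4 * n + 3 + 2 * n]"
    by (simp add: p upt_append add.commute del: upt_Suc)
  have "word_eval A B (two_bridge_word p 3) =
      mpow (B ** A) n ** (B ** (mpow (adj2 A ** adj2 B) n ** (adj2 A ** (mpow (B ** A) n ** B))))"
    unfolding two_bridge_word_def f_def[symmetric] e map_append word_eval_append
    using word_eval_alternating[where k = n and f = f and i = 1, OF f0[OF less_imp_le]]
      word_eval_alternating[where k = n and f = f and i = "2 * n + 2", OF f1[OF less_imp_le]]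
      word_eval_alternating[where k = n and f = f and i = "4 * n + 3", OF f2[OF less_imp_le]]
      f0[of "2 * n"] f1[of "2 * n"] f2[of "2 * n"]
    by (simp add: letter_eval_def)
  moreover define r s where "r = cheb_S (int n - 1) z" and "s = cheb_S (int n) z"
  ultimately have W: "word_eval A B (two_bridge_word p 3) =
      (comb A B (s - r * x * y) (r * y) (r * x) (-r) ** comb A B 0 0 1 0) **
       ((comb A B (r * x * y - (z * r - s)) (- (r * y)) (- (r * x)) r ** comb A B x (-1) 0 0) **
         (comb A B (s - r * x * y) (r * y) (r * x) (-r) ** comb A B 0 0 1 0))"
    by (simp add: matrix_mul_assoc mpow_products comb_generators(2,3)[symmetric])
  have dm: "p div 3 = n" "p mod 3 = 2"
    using p by presburger+
  have Q: "Q_poly p x y z = (x\<^sup>2 + y\<^sup>2) * s\<^sup>2 * r - x * y * s * (s\<^sup>2 + r\<^sup>2) + (z * s ^ 3 - 3 * s\<^sup>2 * r + r ^ 3)"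
    unfolding Q_poly_def Let_def dm s_def r_def cheb_S_triple(2)[symmetric] by simp
  \<comment> \<open>\<open>P\<close> computes the first and last blocks \<open>(ba)^n b\<close>, and
    \<open>N\<close> the middle one. Each block is a palindrome, which is why the
    \<open>A ** B\<close> term cancels.\<close>
  have P: "comb A B (s - r * x * y) (r * y) (r * x) (-r) ** comb A B 0 0 1 0 = comb A B (- (r * x)) r s 0"
    unfolding mult_comb by (intro comb_cong) (simp_all add: algebra_simps)
  have N: "comb A B (r * x * y - (z * r - s)) (- (r * y)) (- (r * x)) r ** comb A B x (-1) 0 0 =
      comb A B (s * x) (-s) (-r) 0"
    unfolding mult_comb by (intro comb_cong) (simp_all add: algebra_simps)
  show ?thesis
    unfolding W P N unfolding mult_comb
    apply (rule ex_comb)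
     apply (unfold Q)
     apply algebra
    apply algebra
    done
qed

end

section \<open>The character variety as a zero set\<close>

text \<open>The commutation hypothesis is the image of the single defining relation, so evaluation
  of words descends to the link group.\<close>

lemma word_eval_word_equiv:
  assumes "word_equiv (two_bridge_relations p m) u v"
    and "det A = 1" "det B = 1"
    and "A ** word_eval A B (two_bridge_word p m) = word_eval A B (two_bridge_word p m) ** A"
  shows "word_eval A B u = word_eval A B v"
  using assms(1)
proof (induction rule: word_equiv.induct)
  case (cancel u g e v)
  have "letter_eval A B (g, e) ** letter_eval A B (g, \<not> e) = mat 1"
    using assms(2,3) by (auto simp: letter_eval_def adj2_inverse split: meridian.split)
  then show ?case by (simp add: matrix_mul_assoc)
next
  case (relation l r u v)
  have "A ** (word_eval A B (two_bridge_word p m) ** M) = word_eval A B (two_bridge_word p m) ** (A ** M)" for M :: "complex^2^2"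
    using assms(4) by (metis matrix_mul_assoc)
  with relation show ?case
    by (simp add: two_bridge_relations_def letter_eval_def flip: matrix_mul_assoc)
qed simp_all

lemma hom_presented_group_word_eval:
  assumes \<rho>: "\<rho> \<in> hom (presented_group R) SL2C"
  defines "A \<equiv> \<rho> (word_class R [(Mer_a, True)])" and "B \<equiv> \<rho> (word_class R [(Mer_b, True)])"
  shows "\<rho> (word_class R u) = word_eval A B u" and "det (\<rho> (word_class R u)) = 1"
proof -
  have det1: "det (\<rho> (word_class R u)) = 1" for u
    using \<rho> by (auto simp: hom_def presented_group_def SL2C_def)
  have mult: "\<rho> (word_class R (u @ v)) = \<rho> (word_class R u) ** \<rho> (word_class R v)" for u v
    unfolding presented_group_mult[symmetric]
    using \<rho> by (simp add: hom_def SL2C_def) (simp add: presented_group_def)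
  have one: "\<rho> (word_class R []) = mat 1"
  proof -
    \<comment> \<open>Membership in \<open>hom\<close> only provides multiplicativity. The image of
      the unit is idempotent and invertible, hence the identity matrix.\<close>
    define E where "E = \<rho> (word_class R [])"
    have "E ** E = E" using mult[of "[]" "[]"] by (simp add: E_def)
    then have "E ** (E ** adj2 E) = E ** adj2 E" by (simp add: matrix_mul_assoc)
    then show ?thesis using det1[of "[]"] by (simp add: adj2_inverse E_def[symmetric])
  qed
  have letter: "\<rho> (word_class R [l]) = letter_eval A B l" for l
  proof -
    obtain g e where l: "l = (g, e)" by force
    have pos: "\<rho> (word_class R [(g, True)]) = letter_eval A B (g, True)"
      by (cases g) (simp_all add: letter_eval_def A_def B_def)
    have "word_class R ([(g, True)] @ [(g, False)]) = word_class R []"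
      using word_equiv.cancel[of R "[]" g True "[]"] by (simp add: word_class_eq_iff)
    then have "\<rho> (word_class R [(g, True)]) ** \<rho> (word_class R [(g, False)]) = mat 1"
      by (metis mult one)
    \<comment> \<open>Multiplying by the adjugate on the left identifies the image of a formal
      inverse.\<close>
    then have "adj2 (\<rho> (word_class R [(g, True)])) ** \<rho> (word_class R [(g, True)]) ** \<rho> (word_class R [(g, False)])
        = adj2 (\<rho> (word_class R [(g, True)]))"
      by (metis matrix_mul_assoc matrix_mul_rid)
    then have "\<rho> (word_class R [(g, False)]) = letter_eval A B (g, False)"
      unfolding adj2_inverse(2)[OF det1] by (simp add: pos) (simp add: letter_eval_def)
    with pos show ?thesis by (cases e) (simp_all add: l)
  qed
  show "\<rho> (word_class R u) = word_eval A B u"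
  proof (induction u)
    case (Cons l u)
    then show ?case using mult[of "[l]" u] by (simp add: letter)
  qed (simp add: one)
  show "det (\<rho> (word_class R u)) = 1" by (rule det1)
qed

text \<open>The universal property of the presentation: homomorphisms correspond to pairs of
  unimodular matrices that satisfy the relation.\<close>

lemma link_character_variety_iff:
  "(x, y, z) \<in> link_character_variety p m \<longleftrightarrow>
     (\<exists>A B. SL2_pair A B x y z \<and>
        A ** word_eval A B (two_bridge_word p m) = word_eval A B (two_bridge_word p m) ** A)"
proof
  assume "(x, y, z) \<in> link_character_variety p m"
  let ?R = "two_bridge_relations p m"
  obtain \<rho> where \<rho>: "\<rho> \<in> hom (presented_group ?R) SL2C"
    and t: "x = trace (\<rho> (word_class ?R [(Mer_a, True)]))" "y = trace (\<rho> (word_class ?R [(Mer_b, True)]))"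
      "z = trace (\<rho> (word_class ?R ([(Mer_a, True)] @ [(Mer_b, True)])))"
    using \<open>(x, y, z) \<in> link_character_variety p m\<close>
    by (auto simp: link_character_variety_def character_variety_def two_bridge_link_group_def
        link_meridian_def presented_group_mult)
  define A B where "A = \<rho> (word_class ?R [(Mer_a, True)])" and "B = \<rho> (word_class ?R [(Mer_b, True)])"
  note h = hom_presented_group_word_eval[OF \<rho>, folded A_def B_def]
  let ?w = "two_bridge_word p m"
  have "word_equiv ?R ([(Mer_a, True)] @ ?w) (?w @ [(Mer_a, True)])"
    using word_equiv.relation[of "[(Mer_a, True)] @ ?w" "?w @ [(Mer_a, True)]" ?R "[]" "[]"]
    by (simp add: two_bridge_relations_def)
  then have "word_eval A B ([(Mer_a, True)] @ ?w) = word_eval A B (?w @ [(Mer_a, True)])"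
    unfolding h(1)[symmetric] by (simp add: word_class_eq_iff[symmetric])
  then have "A ** word_eval A B ?w = word_eval A B ?w ** A"
    by (simp add: letter_eval_def)
  moreover have "SL2_pair A B x y z"
    using h(2)[of "[(Mer_a, True)]"] h(2)[of "[(Mer_b, True)]"] t
    unfolding h(1) by unfold_locales (simp_all add: letter_eval_def)
  ultimately show "\<exists>A B. SL2_pair A B x y z \<and> A ** word_eval A B ?w = word_eval A B ?w ** A"
    by blast
next
  let ?R = "two_bridge_relations p m"
  assume "\<exists>A B. SL2_pair A B x y z \<and>
    A ** word_eval A B (two_bridge_word p m) = word_eval A B (two_bridge_word p m) ** A"
  then obtain A B where "SL2_pair A B x y z"
    and rel: "A ** word_eval A B (two_bridge_word p m) = word_eval A B (two_bridge_word p m) ** A"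
    by blast
  then interpret SL2_pair A B x y z by simp
  \<comment> \<open>A class is evaluated on an arbitrary representative;
    \<open>word_eval_word_equiv\<close> makes the choice immaterial.\<close>
  define \<rho> where "\<rho> X = word_eval A B (SOME u. X = word_class ?R u)" for X
  have \<rho>: "\<rho> (word_class ?R u) = word_eval A B u" for u
  proof -
    have "word_class ?R u = word_class ?R (SOME v. word_class ?R u = word_class ?R v)"
      using someI[of "\<lambda>v. word_class ?R u = word_class ?R v" u] by simp
    then show ?thesis
      unfolding \<rho>_def by (metis word_eval_word_equiv[OF _ det_A det_B rel] word_class_eq_iff)
  qed
  have "\<rho> \<in> hom (presented_group ?R) SL2C"
    unfolding hom_def
  proof (intro CollectI conjI ballI Pi_I)
    fix X assume "X \<in> carrier (presented_group ?R)"
    then obtain u where X: "X = word_class ?R u" by (auto simp: presented_group_def)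
    show "\<rho> X \<in> carrier SL2C"
      by (simp add: X \<rho> SL2C_def det_word_eval det_A det_B)
    fix Y assume "Y \<in> carrier (presented_group ?R)"
    then obtain v where Y: "Y = word_class ?R v" by (auto simp: presented_group_def)
    show "\<rho> (X \<otimes>\<^bsub>presented_group ?R\<^esub> Y) = \<rho> X \<otimes>\<^bsub>SL2C\<^esub> \<rho> Y"
      by (simp add: X Y presented_group_mult \<rho> SL2C_def)
  qed
  moreover have "\<rho> (word_class ?R [(Mer_a, True)]) = A" "\<rho> (word_class ?R [(Mer_b, True)]) = B"
    "\<rho> (word_class ?R [(Mer_a, True), (Mer_b, True)]) = A ** B"
    by (simp_all add: \<rho> letter_eval_def)
  ultimately show "(x, y, z) \<in> link_character_variety p m"
    unfolding link_character_variety_def character_variety_def two_bridge_link_group_def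
      link_meridian_def presented_group_mult
    by (auto simp: x_def y_def z_def intro!: exI[of _ \<rho>])
qed

section \<open>Matrix pairs with prescribed traces\<close>

lemma ex_sum_inverse:
  fixes z :: complex
  shows "\<exists>u. u \<noteq> 0 \<and> z = u + inverse u"
proof -
  \<comment> \<open>A root of \<open>u^2 - z u + 1\<close>; the two roots have product 1 and sum
    \<open>z\<close>.\<close>
  define u where "u = (z + csqrt (z\<^sup>2 - 4)) / 2"
  have "(csqrt (z\<^sup>2 - 4))\<^sup>2 = z\<^sup>2 - 4" by simp
  moreover have "2 * u = z + csqrt (z\<^sup>2 - 4)" by (simp add: u_def)
  then have "csqrt (z\<^sup>2 - 4) = 2 * u - z" by simp
  ultimately have "(2 * u - z)\<^sup>2 = z\<^sup>2 - 4" by simp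
  then have "4 * (u * (z - u)) = 4 * 1" by (simp add: power2_eq_square algebra_simps)
  then have *: "u * (z - u) = 1" by (subst (asm) mult_left_cancel) simp_all
  then have "u \<noteq> 0" by auto
  moreover from * have "inverse u = z - u" by (rule inverse_unique)
  ultimately show ?thesis by (intro exI[of _ u]) simp
qed

text \<open>Once \<open>x = s + 1/s\<close> and \<open>y = t + 1/t\<close>, the cubic factors in
  \<open>z\<close> as \<open>(z - st - 1/(st)) (z - s/t - t/s)\<close>. If the second factor
  vanishes, \<open>t\<close> is replaced by its inverse.\<close>

lemma Cayley_cubic_parametrization:
  fixes x y z :: complex
  assumes "x\<^sup>2 + y\<^sup>2 + z\<^sup>2 - x * y * z - 4 = 0"
  obtains s t where "s \<noteq> 0" "t \<noteq> 0" "x = s + inverse s" "y = t + inverse t"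
    "z = s * t + inverse (s * t)"
proof -
  obtain s where s: "s \<noteq> 0" "x = s + inverse s" using ex_sum_inverse by blast
  obtain t where t: "t \<noteq> 0" "y = t + inverse t" using ex_sum_inverse by blast
  define s' t' where "s' = inverse s" and "t' = inverse t"
  have st: "s * s' = 1" "t * t' = 1" using s t by (simp_all add: s'_def t'_def)
  have "(z - s * t - s' * t') * (z - s * t' - s' * t) = x\<^sup>2 + y\<^sup>2 + z\<^sup>2 - x * y * z - 4"
    unfolding s(2) t(2) s'_def[symmetric] t'_def[symmetric] using st by algebra
  then have "z - s * t - s' * t' = 0 \<or> z - s * t' - s' * t = 0"
    using assms by (metis mult_eq_0_iff)
  then consider "z = s * t + s' * t'" | "z = s * t' + s' * t"
    by (auto simp: algebra_simps)
  then show thesis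
  proof cases
    case 1
    then show thesis using that[of s t] s t by (simp add: s'_def t'_def)
  next
    case 2
    then show thesis using that[of s t'] s t by (simp add: s'_def t'_def)
  qed
qed

definition mat22 :: "complex \<Rightarrow> complex \<Rightarrow> complex \<Rightarrow> complex \<Rightarrow> complex^2^2" where
  "mat22 a b c d = (\<chi> i j. if i = 1 then (if j = 1 then a else b) else (if j = 1 then c else d))"

text \<open>In the explicit pair below, the diagonal entries of the product are \<open>1/u\<close>
  and \<open>u\<close>, with \<open>u\<close> chosen so that they sum to \<open>z\<close>.\<close>

lemma ex_SL2_pair: "\<exists>A B. SL2_pair A B x y z"
proof -
  obtain u where u: "u \<noteq> 0" "z = u + inverse u" using ex_sum_inverse by blast
  have "SL2_pair (mat22 x (-1) 1 0) (mat22 0 u (- inverse u) y) x y z"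
    using u by unfold_locales (simp_all add: mat22_def det_2 trace_2 matrix_mul_2)
  then show ?thesis by blast
qed

text \<open>The parameters of the cubic serve as eigenvalues of two diagonal matrices.\<close>

lemma ex_commuting_SL2_pair:
  assumes "x\<^sup>2 + y\<^sup>2 + z\<^sup>2 - x * y * z - 4 = 0"
  shows "\<exists>A B. SL2_pair A B x y z \<and> A ** B = B ** A"
proof -
  obtain s t where st: "s \<noteq> 0" "t \<noteq> 0" "x = s + inverse s" "y = t + inverse t"
    "z = s * t + inverse (s * t)"
    using assms by (rule Cayley_cubic_parametrization)
  have "SL2_pair (mat22 s 0 0 (inverse s)) (mat22 t 0 0 (inverse t)) x y z"
    using st by unfold_locales (simp_all add: mat22_def det_2 trace_2 matrix_mul_2)
  moreover have "mat22 s 0 0 (inverse s) ** mat22 t 0 0 (inverse t) =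
      mat22 t 0 0 (inverse t) ** mat22 s 0 0 (inverse s)"
    by (simp add: vec_eq_iff forall_2 mat22_def matrix_mul_2)
  ultimately show ?thesis by blast
qed

text \<open>The left-hand side is \<open>- det (AB - BA)\<close>.\<close>

lemma (in SL2_pair) commuting_imp:
  assumes "A ** B = B ** A"
  shows "x\<^sup>2 + y\<^sup>2 + z\<^sup>2 - x * y * z - 4 = 0"
proof -
  obtain a11 a12 a21 a22 where a: "A $ 1 $ 1 = a11" "A $ 1 $ 2 = a12" "A $ 2 $ 1 = a21" "A $ 2 $ 2 = a22" by simp
  obtain b11 b12 b21 b22 where b: "B $ 1 $ 1 = b11" "B $ 1 $ 2 = b12" "B $ 2 $ 1 = b21" "B $ 2 $ 2 = b22" by simp
  have d: "a11 * a22 - a12 * a21 = 1" "b11 * b22 - b12 * b21 = 1"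
    using det_A det_B by (simp_all add: det_2 a b)
  have e: "a11 * b11 + a12 * b21 = b11 * a11 + b12 * a21" "a11 * b12 + a12 * b22 = b11 * a12 + b12 * a22"
    "a21 * b11 + a22 * b21 = b21 * a11 + b22 * a21"
    using assms by (simp_all add: vec_eq_iff forall_2 matrix_mul_2 a b)
  have t: "x = a11 + a22" "y = b11 + b22" "z = a11 * b11 + a12 * b21 + (a21 * b12 + a22 * b22)"
    by (simp_all add: x_def y_def z_def trace_2 matrix_mul_2 a b)
  have "x\<^sup>2 + y\<^sup>2 + z\<^sup>2 - x * y * z - 4 =
    (a12 * b21 - b12 * a21) * (a12 * b21 - b12 * a21) +
    ((a11 * b12 + a12 * b22) - (b11 * a12 + b12 * a22)) * ((a21 * b11 + a22 * b21) - (b21 * a11 + b22 * a21))"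
    unfolding t using d by algebra
  with e show ?thesis by simp
qed

text \<open>Where \<open>Q_p\<close> vanishes, any pair with the given traces satisfies the
  relation. On the cubic a commuting pair has to be selected.\<close>

theorem link_character_variety_3:
  assumes "coprime p 3"
  shows "link_character_variety p 3 =
    {(x, y, z). (x\<^sup>2 + y\<^sup>2 + z\<^sup>2 - x * y * z - 4) * Q_poly p x y z = 0}"
proof -
  have W: "\<exists>c0 c1. word_eval A B (two_bridge_word p 3) = comb A B c0 c1 (- Q_poly p x y z) 0"
    if "SL2_pair A B x y z" for A B x y z
  proof -
    interpret SL2_pair A B x y z by fact
    have "\<not> 3 dvd p" using assms by (auto simp: coprime_absorb_right)
    then have "p = 3 * (p div 3) + 1 \<or> p = 3 * (p div 3) + 2" by presburger
    then show ?thesis using word_eval_two_bridge_1 word_eval_two_bridge_2 by blast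
  qed
  have comm: "A ** word_eval A B (two_bridge_word p 3) = word_eval A B (two_bridge_word p 3) ** A \<longleftrightarrow>
      Q_poly p x y z = 0 \<or> A ** B = B ** A" if "SL2_pair A B x y z" for A B x y z
    using W[OF that] SL2_pair.comb_commute_iff[OF that] by fastforce
  have "(x, y, z) \<in> link_character_variety p 3 \<longleftrightarrow>
      (x\<^sup>2 + y\<^sup>2 + z\<^sup>2 - x * y * z - 4) * Q_poly p x y z = 0" for x y z
    unfolding link_character_variety_iff
    using comm ex_SL2_pair[of x y z] ex_commuting_SL2_pair[of x y z] SL2_pair.commuting_imp
    by (metis mult_eq_0_iff)
  then show ?thesis by auto
qed

section \<open>Irreducible algebraic sets\<close>

text \<open>An induction principle: a class of functions that contains the constants and
  \<open>X\<close>, \<open>Y\<close>, \<open>Z\<close> and is closed under sums and products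
  contains every polynomial in them. It serves both for continuity and for clearing
  denominators.\<close>

lemma eval3_induct:
  assumes const: "\<And>c. C (\<lambda>_. c)" and X: "C X" and Y: "C Y" and Z: "C Z"
    and add: "\<And>f g. C f \<Longrightarrow> C g \<Longrightarrow> C (\<lambda>t. f t + g t)"
    and mult: "\<And>f g. C f \<Longrightarrow> C g \<Longrightarrow> C (\<lambda>t. f t * g t)"
  shows "C (\<lambda>t. eval3 P (X t, Y t, Z t))"
proof -
  have 1: "C (\<lambda>t. poly p (X t))" for p
    by (induction p) (auto intro!: const add mult X)
  have 2: "C (\<lambda>t. poly (poly p [:Y t:]) (X t))" for p
    by (induction p) (auto intro!: const add mult 1 Y)
  show ?thesis unfolding eval3_def case_prod_conv
    by (induction P) (auto intro!: const add mult 2 Z)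
qed

lemma continuous_on_eval3: "continuous_on UNIV (eval3 P)"
proof -
  have "continuous_on UNIV (\<lambda>v. eval3 P (fst v, fst (snd v), snd (snd v)))"
    by (rule eval3_induct) (auto intro!: continuous_intros)
  then show ?thesis by simp
qed

section \<open>Polynomial functions and algebraic sets\<close>

definition polynomial_fun :: "(complex \<times> complex \<times> complex \<Rightarrow> complex) \<Rightarrow> bool" where
  "polynomial_fun f \<longleftrightarrow> (\<exists>P. f = eval3 P)"

lemma polynomial_fun_add: "polynomial_fun f \<Longrightarrow> polynomial_fun g \<Longrightarrow> polynomial_fun (\<lambda>v. f v + g v)"
  unfolding polynomial_fun_def
proof (elim exE)
  fix P Q assume "f = eval3 P" "g = eval3 Q"
  then show "\<exists>R. (\<lambda>v. f v + g v) = eval3 R"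
    by (intro exI[of _ "P + Q"]) (auto simp: eval3_def)
qed

lemma polynomial_fun_mult: "polynomial_fun f \<Longrightarrow> polynomial_fun g \<Longrightarrow> polynomial_fun (\<lambda>v. f v * g v)"
  unfolding polynomial_fun_def
proof (elim exE)
  fix P Q assume "f = eval3 P" "g = eval3 Q"
  then show "\<exists>R. (\<lambda>v. f v * g v) = eval3 R"
    by (intro exI[of _ "P * Q"]) (auto simp: eval3_def)
qed

lemma polynomial_fun_const: "polynomial_fun (\<lambda>_. c)"
  unfolding polynomial_fun_def by (intro exI[of _ "[:[:[:c:]:]:]"]) (auto simp: eval3_def)

lemma polynomial_fun_coordinates:
  "polynomial_fun fst" "polynomial_fun (\<lambda>v. fst (snd v))" "polynomial_fun (\<lambda>v. snd (snd v))"
proof -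
  have "fst = eval3 [:[:[:0, 1:]:]:]" "(\<lambda>v. fst (snd v)) = eval3 [:[:0, 1:]:]"
    "(\<lambda>v. snd (snd v)) = eval3 [:0, 1:]"
    by (auto simp: eval3_def)
  then show "polynomial_fun fst" "polynomial_fun (\<lambda>v. fst (snd v))" "polynomial_fun (\<lambda>v. snd (snd v))"
    unfolding polynomial_fun_def by blast+
qed

lemma polynomial_fun_diff: "polynomial_fun f \<Longrightarrow> polynomial_fun g \<Longrightarrow> polynomial_fun (\<lambda>v. f v - g v)"
  using polynomial_fun_add[of f "\<lambda>v. -1 * g v"] polynomial_fun_mult[OF polynomial_fun_const, of g "-1"]
  by simp

lemma polynomial_fun_power: "polynomial_fun f \<Longrightarrow> polynomial_fun (\<lambda>v. f v ^ n)"
  by (induction n) (simp_all add: polynomial_fun_mult polynomial_fun_const)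

lemma polynomial_fun_poly: "polynomial_fun f \<Longrightarrow> polynomial_fun (\<lambda>v. poly p (f v))"
  by (induction p) (simp_all add: polynomial_fun_add polynomial_fun_mult polynomial_fun_const)

lemmas polynomial_fun_intros = polynomial_fun_add polynomial_fun_mult polynomial_fun_const
  polynomial_fun_coordinates polynomial_fun_diff polynomial_fun_power polynomial_fun_poly

lemma algebraic_set_zeros: "polynomial_fun f \<Longrightarrow> algebraic_set {v. f v = 0}"
  unfolding polynomial_fun_def algebraic_set_def
proof (elim exE)
  fix P assume "f = eval3 P"
  then show "\<exists>F. {v. f v = 0} = zero_set F"
    by (intro exI[of _ "{P}"]) (simp add: zero_set_def)
qed

lemma algebraic_set_Int: "algebraic_set V \<Longrightarrow> algebraic_set W \<Longrightarrow> algebraic_set (V \<inter> W)"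
  unfolding algebraic_set_def
proof (elim exE)
  fix F G assume "V = zero_set F" "W = zero_set G"
  then show "\<exists>H. V \<inter> W = zero_set H"
    by (intro exI[of _ "F \<union> G"]) (auto simp: zero_set_def)
qed

text \<open>Clearing denominators. The exponent depends on \<open>P\<close>; exponents add for sums
  as well as products, which avoids taking a maximum.\<close>

lemma eval3_rational_curve:
  fixes X Y Z d :: "complex poly"
  shows "\<exists>N k. \<forall>t. poly d t \<noteq> 0 \<longrightarrow>
    eval3 P (poly X t / poly d t, poly Y t / poly d t, poly Z t / poly d t) * poly d t ^ k = poly N t"
proof (rule eval3_induct[where C = "\<lambda>f. \<exists>N k. \<forall>t. poly d t \<noteq> 0 \<longrightarrow> f t * poly d t ^ k = poly N t"])
  show "\<exists>N k. \<forall>t. poly d t \<noteq> 0 \<longrightarrow> c * poly d t ^ k = poly N t" for c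
    by (intro exI[of _ "[:c:]"] exI[of _ 0]) simp
  have "\<exists>N k. \<forall>t. poly d t \<noteq> 0 \<longrightarrow> poly X t / poly d t * poly d t ^ k = poly N t" for X
    by (intro exI[of _ X] exI[of _ 1]) simp
  then show "\<exists>N k. \<forall>t. poly d t \<noteq> 0 \<longrightarrow> poly X t / poly d t * poly d t ^ k = poly N t"
    "\<exists>N k. \<forall>t. poly d t \<noteq> 0 \<longrightarrow> poly Y t / poly d t * poly d t ^ k = poly N t"
    "\<exists>N k. \<forall>t. poly d t \<noteq> 0 \<longrightarrow> poly Z t / poly d t * poly d t ^ k = poly N t"
    by blast+
next
  fix f g
  assume "\<exists>N k. \<forall>t. poly d t \<noteq> 0 \<longrightarrow> f t * poly d t ^ k = poly N t"
    "\<exists>N k. \<forall>t. poly d t \<noteq> 0 \<longrightarrow> g t * poly d t ^ k = poly N t"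
  then obtain N k M l where f: "\<And>t. poly d t \<noteq> 0 \<Longrightarrow> f t * poly d t ^ k = poly N t"
    and g: "\<And>t. poly d t \<noteq> 0 \<Longrightarrow> g t * poly d t ^ l = poly M t"
    by blast
  show "\<exists>N k. \<forall>t. poly d t \<noteq> 0 \<longrightarrow> (f t + g t) * poly d t ^ k = poly N t"
    by (intro exI[of _ "N * d ^ l + M * d ^ k"] exI[of _ "k + l"])
      (simp add: f[symmetric] g[symmetric] power_add algebra_simps)
  show "\<exists>N k. \<forall>t. poly d t \<noteq> 0 \<longrightarrow> (f t * g t) * poly d t ^ k = poly N t"
    by (intro exI[of _ "N * M"] exI[of _ "k + l"])
      (simp add: f[symmetric] g[symmetric] power_add algebra_simps)
qed

text \<open>Two polynomials, each nonzero somewhere on a rational curve, have only finitely many zeros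
  on it, so the curve is not covered by their zero sets.\<close>

lemma irreducible_set_rational_curves:
  assumes V: "algebraic_set V" "V \<noteq> {}" and dense: "V \<subseteq> closure U"
    and curve: "\<And>v w. v \<in> U \<Longrightarrow> w \<in> U \<Longrightarrow> \<exists>X Y Z d a b.
      poly d a \<noteq> 0 \<and> v = (poly X a / poly d a, poly Y a / poly d a, poly Z a / poly d a) \<and>
      poly d b \<noteq> 0 \<and> w = (poly X b / poly d b, poly Y b / poly d b, poly Z b / poly d b) \<and>
      (\<forall>t. poly d t \<noteq> 0 \<longrightarrow> (poly X t / poly d t, poly Y t / poly d t, poly Z t / poly d t) \<in> V)"
  shows "irreducible_set V"
  unfolding irreducible_set_def
proof (intro conjI allI impI V)
  fix V1 V2 assume "algebraic_set V1 \<and> algebraic_set V2 \<and> V = V1 \<union> V2"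
  then obtain F1 F2 where F: "V1 = zero_set F1" "V2 = zero_set F2" and V12: "V = V1 \<union> V2"
    by (auto simp: algebraic_set_def)
  \<comment> \<open>The zero set of \<open>P\<close> is closed, so a polynomial that vanishes on
    \<open>U\<close> vanishes on the closure and hence on \<open>V\<close>.\<close>
  have witness: "\<exists>P\<in>F. \<exists>u\<in>U. eval3 P u \<noteq> 0" if nsub: "\<not> V \<subseteq> zero_set F" for F
  proof -
    obtain v where "v \<in> V" "v \<notin> zero_set F" using nsub by blast
    moreover from this obtain P where "P \<in> F" "eval3 P v \<noteq> 0"
      unfolding zero_set_def by blast
    ultimately have v: "v \<in> V" "P \<in> F" "eval3 P v \<noteq> 0" by auto
    have "closed {u. eval3 P u = 0}"
      using continuous_closed_vimage[of "{0}" "eval3 P"] continuous_on_eval3[of P]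
      by (auto simp: vimage_def continuous_on_eq_continuous_at)
    then have "\<not> U \<subseteq> {u. eval3 P u = 0}"
      using closure_minimal[of U "{u. eval3 P u = 0}"] v dense by auto
    with v show ?thesis by auto
  qed
  show "V = V1 \<or> V = V2"
  proof (rule ccontr)
    assume "\<not> (V = V1 \<or> V = V2)"
    then have "\<not> V \<subseteq> zero_set F1" "\<not> V \<subseteq> zero_set F2"
      using V12 F by auto
    then obtain P1 P2 v w where P: "P1 \<in> F1" "P2 \<in> F2" and vw: "v \<in> U" "w \<in> U"
      and nz: "eval3 P1 v \<noteq> 0" "eval3 P2 w \<noteq> 0"
      using witness by meson
    obtain X Y Z d a b where a: "poly d a \<noteq> 0" "v = (poly X a / poly d a, poly Y a / poly d a, poly Z a / poly d a)"
      and b: "poly d b \<noteq> 0" "w = (poly X b / poly d b, poly Y b / poly d b, poly Z b / poly d b)"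
      and in_V: "\<And>t. poly d t \<noteq> 0 \<Longrightarrow> (poly X t / poly d t, poly Y t / poly d t, poly Z t / poly d t) \<in> V"
      using curve[OF vw] by blast
    let ?c = "\<lambda>t. (poly X t / poly d t, poly Y t / poly d t, poly Z t / poly d t)"
    obtain N1 k1 where 1: "\<And>t. poly d t \<noteq> 0 \<Longrightarrow> eval3 P1 (?c t) * poly d t ^ k1 = poly N1 t"
      using eval3_rational_curve[of d P1 X Y Z] by blast
    obtain N2 k2 where 2: "\<And>t. poly d t \<noteq> 0 \<Longrightarrow> eval3 P2 (?c t) * poly d t ^ k2 = poly N2 t"
      using eval3_rational_curve[of d P2 X Y Z] by blast
    have "poly N1 a \<noteq> 0" "poly N2 b \<noteq> 0" "poly d a \<noteq> 0"
      using 1[of a] 2[of b] a b nz by auto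
    then have "N1 * N2 * d \<noteq> 0" by auto
    then obtain t where "poly (N1 * N2 * d) t \<noteq> 0"
      using poly_all_0_iff_0 by blast
    then have "poly d t \<noteq> 0" "eval3 P1 (?c t) \<noteq> 0" "eval3 P2 (?c t) \<noteq> 0"
      using 1[of t] 2[of t] by auto
    then have "?c t \<notin> V1 \<union> V2" using P by (auto simp: F zero_set_def)
    with in_V[OF \<open>poly d t \<noteq> 0\<close>] V12 show False by simp
  qed
qed

section \<open>Irreducible components of a union\<close>

lemma irreducible_set_subset_Un:
  assumes "irreducible_set W" "algebraic_set V1" "algebraic_set V2" "W \<subseteq> V1 \<union> V2"
  shows "W \<subseteq> V1 \<or> W \<subseteq> V2"
proof -
  have "W = (W \<inter> V1) \<union> (W \<inter> V2)" using assms(4) by blast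
  moreover have "algebraic_set W"
    using assms(1) by (simp add: irreducible_set_def)
  then have "algebraic_set (W \<inter> V1)" "algebraic_set (W \<inter> V2)"
    using assms(2,3) algebraic_set_Int by simp_all
  ultimately have "W = W \<inter> V1 \<or> W = W \<inter> V2"
    using assms(1) unfolding irreducible_set_def by meson
  then show ?thesis by blast
qed

text \<open>Any irreducible subset of the union lies in one of the two sets, and since these are
  incomparable, both are maximal.\<close>

lemma irreducible_components_Un:
  assumes "irreducible_set V1" "irreducible_set V2" "\<not> V1 \<subseteq> V2" "\<not> V2 \<subseteq> V1"
  shows "irreducible_components (V1 \<union> V2) = {V1, V2}"
proof -
  have *: "W \<subseteq> V1 \<or> W \<subseteq> V2" if "irreducible_set W" "W \<subseteq> V1 \<union> V2" for W
    using that assms(1,2) by (intro irreducible_set_subset_Un) (auto simp: irreducible_set_def)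
  show ?thesis
  proof (intro equalityI subsetI)
    fix V assume "V \<in> irreducible_components (V1 \<union> V2)"
    then have V: "irreducible_set V" "V \<subseteq> V1 \<union> V2"
      "\<And>W. irreducible_set W \<Longrightarrow> V \<subseteq> W \<Longrightarrow> W \<subseteq> V1 \<union> V2 \<Longrightarrow> W = V"
      by (auto simp: irreducible_components_def)
    from *[OF V(1,2)] show "V \<in> {V1, V2}"
      using V(3)[of V1] V(3)[of V2] assms by auto
  next
    fix V assume V: "V \<in> {V1, V2}"
    have "W = V" if "irreducible_set W" "V \<subseteq> W" "W \<subseteq> V1 \<union> V2" for W
      using *[OF that(1,3)] that(2) V assms(3,4) by blast
    then show "V \<in> irreducible_components (V1 \<union> V2)"
      using V assms(1,2) by (auto simp: irreducible_components_def)
  qed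
qed

text \<open>The roots have product \<open>e / a\<close>, so the smaller one satisfies the bound. The
  bound does not involve \<open>b\<close>.\<close>

lemma quadratic_small_root:
  fixes a b e :: complex
  assumes "a \<noteq> 0"
  shows "\<exists>w. a * w\<^sup>2 + b * w + e = 0 \<and> (norm w)\<^sup>2 \<le> norm (e / a)"
proof -
  define D where "D = csqrt (b\<^sup>2 - 4 * a * e)"
  have D: "D\<^sup>2 = b\<^sup>2 - 4 * a * e" by (simp add: D_def)
  define w1 w2 where "w1 = (- b + D) / (2 * a)" and "w2 = (- b - D) / (2 * a)"
  have root: "a * w1\<^sup>2 + b * w1 + e = 0" "a * w2\<^sup>2 + b * w2 + e = 0"
  proof -
    have h: "2 * a * w1 = - b + D" "2 * a * w2 = - b - D" using assms by (simp_all add: w1_def w2_def)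
    have "4 * a * (a * w\<^sup>2 + b * w + e) = (2 * a * w + b)\<^sup>2 - D\<^sup>2" for w
      unfolding D by (simp add: power2_eq_square algebra_simps)
    then have "4 * a * (a * w1\<^sup>2 + b * w1 + e) = 0" "4 * a * (a * w2\<^sup>2 + b * w2 + e) = 0"
      by (simp_all add: h)
    then show "a * w1\<^sup>2 + b * w1 + e = 0" "a * w2\<^sup>2 + b * w2 + e = 0"
      using assms by simp_all
  qed
  have "w1 * w2 = (b\<^sup>2 - D\<^sup>2) / (4 * a\<^sup>2)"
    by (simp add: w1_def w2_def power2_eq_square algebra_simps)
  also have "\<dots> = e / a" unfolding D using assms by (simp add: field_simps power2_eq_square)
  finally have prod: "norm w1 * norm w2 = norm (e / a)" by (metis norm_mult)
  show ?thesis
  proof (cases "norm w1 \<le> norm w2")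
    case True
    then have "(norm w1)\<^sup>2 \<le> norm (e / a)"
      unfolding prod[symmetric] power2_eq_square by (intro mult_left_mono) auto
    with root show ?thesis by blast
  next
    case False
    then have "(norm w2)\<^sup>2 \<le> norm (e / a)"
      unfolding prod[symmetric] power2_eq_square by (intro mult_right_mono) auto
    with root show ?thesis by blast
  qed
qed

lemma eventually_poly_nonzero:
  fixes p :: "complex poly"
  assumes "p \<noteq> 0"
  shows "eventually (\<lambda>z. poly p z \<noteq> 0) (at z0)"
proof -
  let ?S = "{z. poly p z = 0} - {z0}"
  have "finite ?S" using poly_roots_finite[OF assms] by simp
  then have "open (- ?S)" by (intro open_Compl finite_imp_closed)
  then have "eventually (\<lambda>z. z \<in> - ?S) (nhds z0)" by (intro eventually_nhds_in_open) auto
  then have "eventually (\<lambda>z. z \<in> - ?S) (at z0)"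
    by (auto simp: eventually_at_filter elim: eventually_mono)
  moreover have "eventually (\<lambda>z. z \<noteq> z0) (at z0)" by (simp add: eventually_at_filter)
  ultimately show ?thesis by eventually_elim auto
qed

lemma norm_triple_le: "norm (x, y, z) \<le> norm x + norm y + norm z"
  using norm_Pair_le[of x "(y, z)"] norm_Pair_le[of y z] by linarith

section \<open>The two components\<close>

lemma irreducible_Cayley_cubic:
  "irreducible_set {(x, y, z). x\<^sup>2 + y\<^sup>2 + z\<^sup>2 - x * y * z - 4 = 0}"
proof -
  define V :: "(complex \<times> complex \<times> complex) set"
    where "V = {(x, y, z). x\<^sup>2 + y\<^sup>2 + z\<^sup>2 - x * y * z - 4 = 0}"
  have V_eq: "V = {v. (fst v)\<^sup>2 + (fst (snd v))\<^sup>2 + (snd (snd v))\<^sup>2 - fst v * fst (snd v) * snd (snd v) - 4 = 0}"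
    by (auto simp: V_def)
  define \<phi> :: "complex \<Rightarrow> complex \<Rightarrow> complex \<times> complex \<times> complex"
    where "\<phi> s t = (s + inverse s, t + inverse t, s * t + inverse (s * t))" for s t
  have \<phi>_in: "\<phi> s t \<in> V" if "s \<noteq> 0" "t \<noteq> 0" for s t
  proof -
    define s' t' where "s' = inverse s" and "t' = inverse t"
    have "s * s' = 1" "t * t' = 1" using that by (simp_all add: s'_def t'_def)
    then have "(s + s')\<^sup>2 + (t + t')\<^sup>2 + (s * t + s' * t')\<^sup>2 - (s + s') * (t + t') * (s * t + s' * t') - 4 = 0"
      by algebra
    then show ?thesis by (simp add: V_def \<phi>_def s'_def t'_def)
  qed
  have surj: "\<exists>s t. s \<noteq> 0 \<and> t \<noteq> 0 \<and> v = \<phi> s t" if "v \<in> V" for v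
  proof -
    obtain x y z where xyz: "v = (x, y, z)" by (metis prod_cases3)
    then have "x\<^sup>2 + y\<^sup>2 + z\<^sup>2 - x * y * z - 4 = 0" using that by (simp add: V_def)
    then show ?thesis
      by (rule Cayley_cubic_parametrization) (auto simp: xyz \<phi>_def)
  qed
  have "irreducible_set V"
  proof (rule irreducible_set_rational_curves)
    show "algebraic_set V" unfolding V_eq
      by (intro algebraic_set_zeros polynomial_fun_intros)
    show "V \<noteq> {}" using \<phi>_in[of 1 1] by auto
    show "V \<subseteq> closure V" by (rule closure_subset)
    fix v w assume "v \<in> V" "w \<in> V"
    then obtain s1 t1 s2 t2 where v: "s1 \<noteq> 0" "t1 \<noteq> 0" "v = \<phi> s1 t1"
      and w: "s2 \<noteq> 0" "t2 \<noteq> 0" "w = \<phi> s2 t2"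
      using surj by meson
    \<comment> \<open>The line from \<open>(s1, t1)\<close> to \<open>(s2, t2)\<close> in the
      parameter plane, reached at times 0 and 1.\<close>
    define S T where "S = [:s1, s2 - s1:]" and "T = [:t1, t2 - t1:]"
    have ends: "poly S 0 = s1" "poly T 0 = t1" "poly S 1 = s2" "poly T 1 = t2"
      by (simp_all add: S_def T_def)
    \<comment> \<open>\<open>S * T\<close> is a common denominator for the three coordinates; its
      zeros are the times at which the line leaves the domain of \<open>\<phi>\<close>.\<close>
    define d X Y Z where "d = S * T" and "X = (S ^ 2 + 1) * T" and "Y = (T ^ 2 + 1) * S"
      and "Z = (S * T) ^ 2 + 1"
    have param: "(poly X u / poly d u, poly Y u / poly d u, poly Z u / poly d u) = \<phi> (poly S u) (poly T u)"
      if "poly d u \<noteq> 0" for u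
      using that by (simp add: d_def X_def Y_def Z_def \<phi>_def field_simps power2_eq_square)
    have d: "poly d 0 \<noteq> 0" "poly d 1 \<noteq> 0" using v w by (simp_all add: d_def ends)
    show "\<exists>X Y Z d a b.
      poly d a \<noteq> 0 \<and> v = (poly X a / poly d a, poly Y a / poly d a, poly Z a / poly d a) \<and>
      poly d b \<noteq> 0 \<and> w = (poly X b / poly d b, poly Y b / poly d b, poly Z b / poly d b) \<and>
      (\<forall>t. poly d t \<noteq> 0 \<longrightarrow> (poly X t / poly d t, poly Y t / poly d t, poly Z t / poly d t) \<in> V)"
    proof (intro exI conjI allI impI)
      show "poly d 0 \<noteq> 0" "poly d 1 \<noteq> 0" by (fact d)+
      show "v = (poly X 0 / poly d 0, poly Y 0 / poly d 0, poly Z 0 / poly d 0)"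
        unfolding param[OF d(1)] ends by (rule v)
      show "w = (poly X 1 / poly d 1, poly Y 1 / poly d 1, poly Z 1 / poly d 1)"
        unfolding param[OF d(2)] ends by (rule w)
      show "(poly X t / poly d t, poly Y t / poly d t, poly Z t / poly d t) \<in> V" if "poly d t \<noteq> 0" for t
        unfolding param[OF that] using that by (intro \<phi>_in) (auto simp: d_def)
    qed
  qed
  then show ?thesis by (simp add: V_def)
qed

text \<open>A family of plane conics over the \<open>z\<close>-line whose quadratic part splits into
  two linear forms. \<open>c_g\<close> makes the fibres with \<open>c = 0\<close> empty,
  \<open>s_r\<close> keeps the linear forms from vanishing identically, and \<open>nonzero\<close>
  leaves only finitely many special fibres.\<close>

locale split_conic_bundle =
  fixes c s r g :: "complex poly"
  assumes c_g: "\<And>z. poly c z = 0 \<Longrightarrow> poly g z \<noteq> 0"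
    and s_r: "\<And>z. poly s z = 0 \<Longrightarrow> poly r z \<noteq> 0"
    and nonzero: "c * g * (s\<^sup>2 - r\<^sup>2) \<noteq> 0"
begin

definition form :: "complex \<Rightarrow> complex \<Rightarrow> complex \<Rightarrow> complex" where
  "form x y z = poly c z * (poly s z * x - poly r z * y) * (poly r z * x - poly s z * y) + poly g z"

definition surface :: "(complex \<times> complex \<times> complex) set" where
  "surface = {(x, y, z). form x y z = 0}"

text \<open>The fibres where \<open>u = s x - r y\<close> is a coordinate:
  \<open>g \<noteq> 0\<close> forces \<open>u \<noteq> 0\<close>, and
  \<open>s^2 - r^2 \<noteq> 0\<close> makes the two linear forms independent.\<close>

definition generic_part :: "(complex \<times> complex \<times> complex) set" where
  "generic_part = {(x, y, z). form x y z = 0 \<and> poly (c * g * (s\<^sup>2 - r\<^sup>2)) z \<noteq> 0}"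

lemma algebraic_surface: "algebraic_set surface"
proof -
  have "surface = {v. poly c (snd (snd v)) * (poly s (snd (snd v)) * fst v - poly r (snd (snd v)) * fst (snd v)) *
      (poly r (snd (snd v)) * fst v - poly s (snd (snd v)) * fst (snd v)) + poly g (snd (snd v)) = 0}"
    by (auto simp: surface_def form_def)
  also have "algebraic_set \<dots>"
    by (intro algebraic_set_zeros polynomial_fun_intros)
  finally show ?thesis .
qed

text \<open>Through every point of the surface there is a direction \<open>(1, \<plusminus>1, 0)\<close> in which the
  restriction of the form to nearby fibres is a genuine quadratic, whose roots depend
  continuously on the fibre.\<close>

lemma surface_subset_closure: "surface \<subseteq> closure generic_part"
proof
  fix v assume "v \<in> surface"
  then obtain x y z0 where v: "v = (x, y, z0)" and zero: "form x y z0 = 0"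
    by (auto simp: surface_def)
  have c0: "poly c z0 \<noteq> 0" using zero c_g[of z0] by (auto simp: form_def)
  \<comment> \<open>The leading coefficient in direction \<open>(1, e, 0)\<close> is
    \<open>- e c (s - e r)^2\<close>. It cannot vanish for both signs, as \<open>s\<close> and
    \<open>r\<close> would then both be 0.\<close>
  obtain e :: complex where e: "e * e = 1" "poly s z0 - e * poly r z0 \<noteq> 0"
  proof (cases "poly s z0 = poly r z0")
    case True
    then have "poly s z0 + poly r z0 \<noteq> 0" using s_r[of z0] by auto
    then show thesis using that[of "-1"] by simp
  next
    case False
    then show thesis using that[of 1] by simp
  qed
  define a where "a z = - e * poly c z * (poly s z - e * poly r z)\<^sup>2" for z
  define b where "b z = poly c z * ((poly s z - e * poly r z) * (poly r z * x - poly s z * y)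
      + (poly r z - e * poly s z) * (poly s z * x - poly r z * y))" for z
  have expand: "form (x + w) (y + e * w) z = a z * w\<^sup>2 + b z * w + form x y z" for w z
    using e(1) unfolding form_def a_def b_def by algebra
  have e0: "e \<noteq> 0" using e(1) by auto
  have a0: "a z0 \<noteq> 0" using c0 e e0 by (simp add: a_def)
  have norm_e: "norm e = 1"
    using e(1) by (metis norm_mult norm_one norm_ge_zero abs_of_nonneg power2_eq_square real_sqrt_abs real_sqrt_one)
  show "v \<in> closure generic_part"
    unfolding closure_approachable
  proof (intro allI impI)
    fix \<delta> :: real assume "\<delta> > 0"
    have cont: "isCont a z0" "isCont (\<lambda>z. norm (form x y z / a z)) z0"
      using a0 unfolding a_def form_def by (auto intro!: continuous_intros)
    have "((\<lambda>z. norm (form x y z / a z)) \<longlongrightarrow> 0) (at z0)"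
      using cont(2) zero by (simp add: isCont_def)
    then have "eventually (\<lambda>z. norm (form x y z / a z) < (\<delta> / 3)\<^sup>2) (at z0)"
      using \<open>\<delta> > 0\<close> by (intro order_tendstoD(2)) auto
    moreover have "eventually (\<lambda>z. a z \<noteq> 0) (at z0)"
      using cont(1) a0 by (intro tendsto_imp_eventually_ne) (auto simp: isCont_def)
    moreover have "eventually (\<lambda>z. poly (c * g * (s\<^sup>2 - r\<^sup>2)) z \<noteq> 0) (at z0)"
      by (rule eventually_poly_nonzero[OF nonzero])
    moreover have "eventually (\<lambda>z. dist z z0 < \<delta> / 3) (at z0)"
      using \<open>\<delta> > 0\<close> unfolding eventually_at by (intro exI[of _ "\<delta> / 3"]) auto
    ultimately have "eventually (\<lambda>z. norm (form x y z / a z) < (\<delta> / 3)\<^sup>2 \<and> a z \<noteq> 0 \<and>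
        poly (c * g * (s\<^sup>2 - r\<^sup>2)) z \<noteq> 0 \<and> dist z z0 < \<delta> / 3) (at z0)"
      by eventually_elim simp
    then obtain z where z: "norm (form x y z / a z) < (\<delta> / 3)\<^sup>2" "a z \<noteq> 0"
        "poly (c * g * (s\<^sup>2 - r\<^sup>2)) z \<noteq> 0" "dist z z0 < \<delta> / 3"
      using eventually_happens'[of "at z0"] by fastforce
    \<comment> \<open>The constant term tends to 0 as \<open>z\<close> approaches \<open>z0\<close>,
      so a small root \<open>w\<close> moves the point only slightly.\<close>
    obtain w where w: "a z * w\<^sup>2 + b z * w + form x y z = 0" "(norm w)\<^sup>2 \<le> norm (form x y z / a z)"
      using quadratic_small_root[OF z(2)] by blast
    have "(norm w)\<^sup>2 < (\<delta> / 3)\<^sup>2" using w(2) z(1) by linarith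
    then have "norm w < \<delta> / 3" by (rule power2_less_imp_less) (use \<open>\<delta> > 0\<close> in simp)
    moreover have "norm (w, e * w, z - z0) \<le> norm w + norm (e * w) + norm (z - z0)"
      by (rule norm_triple_le)
    ultimately have "norm (w, e * w, z - z0) < \<delta>"
      using z(4) by (simp add: norm_mult norm_e dist_norm)
    then have "dist (x + w, y + e * w, z) v < \<delta>"
      by (simp add: dist_norm v)
    moreover have "(x + w, y + e * w, z) \<in> generic_part"
      using w(1) z(3) by (simp add: generic_part_def expand)
    ultimately show "\<exists>u\<in>generic_part. dist u v < \<delta>" by blast
  qed
qed

text \<open>The two quotients solve the linear system \<open>s X - r Y = u\<close>,
  \<open>c u (r X - s Y) = - g\<close>, whose equations together make the form vanish.\<close>

lemma form_zero_param:
  assumes "poly c z * u * ((poly s z)\<^sup>2 - (poly r z)\<^sup>2) \<noteq> 0"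
  defines "D \<equiv> poly c z * u * ((poly s z)\<^sup>2 - (poly r z)\<^sup>2)"
  shows "form ((poly c z * poly s z * u\<^sup>2 + poly r z * poly g z) / D)
    ((poly c z * poly r z * u\<^sup>2 + poly s z * poly g z) / D) z = 0"
proof -
  define X Y where "X = (poly c z * poly s z * u\<^sup>2 + poly r z * poly g z) / D"
    and "Y = (poly c z * poly r z * u\<^sup>2 + poly s z * poly g z) / D"
  have D: "D \<noteq> 0" using assms by simp
  have h: "D * X = poly c z * poly s z * u\<^sup>2 + poly r z * poly g z"
    "D * Y = poly c z * poly r z * u\<^sup>2 + poly s z * poly g z"
    using D by (simp_all add: X_def Y_def)
  have "D * (poly s z * X - poly r z * Y) = poly s z * (D * X) - poly r z * (D * Y)"
    by (simp add: algebra_simps)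
  also have "\<dots> = D * u" unfolding h by (simp add: D_def algebra_simps power2_eq_square)
  finally have 1: "poly s z * X - poly r z * Y = u" using D by simp
  have "D * (poly c z * u * (poly r z * X - poly s z * Y)) = poly c z * u * (poly r z * (D * X) - poly s z * (D * Y))"
    by (simp add: algebra_simps)
  also have "\<dots> = D * (- poly g z)" unfolding h by (simp add: D_def algebra_simps power2_eq_square)
  finally have 2: "poly c z * u * (poly r z * X - poly s z * Y) = - poly g z"
    by (metis D mult_left_cancel)
  show ?thesis using 1 2 by (simp add: form_def X_def Y_def)
qed

text \<open>The converse: a generic point is recovered from \<open>(z, u)\<close> by solving the
  same linear system.\<close>

lemma generic_param:
  assumes "(x, y, z) \<in> generic_part"
  defines "u \<equiv> poly s z * x - poly r z * y"
  defines "D \<equiv> poly c z * u * ((poly s z)\<^sup>2 - (poly r z)\<^sup>2)"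
  shows "D \<noteq> 0" and "x = (poly c z * poly s z * u\<^sup>2 + poly r z * poly g z) / D"
    and "y = (poly c z * poly r z * u\<^sup>2 + poly s z * poly g z) / D"
proof -
  have *: "poly c z * u * (poly r z * x - poly s z * y) + poly g z = 0" "poly g z \<noteq> 0"
    "poly c z \<noteq> 0" "(poly s z)\<^sup>2 - (poly r z)\<^sup>2 \<noteq> 0"
    using assms by (auto simp: generic_part_def form_def)
  then have "u \<noteq> 0" by auto
  with * show D: "D \<noteq> 0" by (simp add: D_def)
  have g: "poly g z = - (poly c z * u * (poly r z * x - poly s z * y))"
    using *(1) by (simp add: eq_neg_iff_add_eq_0 add.commute)
  have "x * D = poly c z * poly s z * u\<^sup>2 + poly r z * poly g z"
    "y * D = poly c z * poly r z * u\<^sup>2 + poly s z * poly g z"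
    unfolding g D_def u_def by (simp_all add: algebra_simps power2_eq_square)
  with D show "x = (poly c z * poly s z * u\<^sup>2 + poly r z * poly g z) / D"
    "y = (poly c z * poly r z * u\<^sup>2 + poly s z * poly g z) / D"
    by (simp_all add: nonzero_eq_divide_eq)
qed

lemma irreducible_surface:
  assumes "surface \<noteq> {}"
  shows "irreducible_set surface"
proof (rule irreducible_set_rational_curves[OF algebraic_surface assms surface_subset_closure])
  fix v w assume "v \<in> generic_part" "w \<in> generic_part"
  moreover obtain x1 y1 z1 x2 y2 z2 where v: "v = (x1, y1, z1)" and w: "w = (x2, y2, z2)"
    by (metis prod_cases3)
  ultimately have in_generic: "(x1, y1, z1) \<in> generic_part" "(x2, y2, z2) \<in> generic_part" by simp_all
  define u1 u2 where "u1 = poly s z1 * x1 - poly r z1 * y1" and "u2 = poly s z2 * x2 - poly r z2 * y2"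
  \<comment> \<open>Generic points are joined by a line in the \<open>(z, u)\<close>-plane.
    Composing with \<open>z\<close> makes all coefficients polynomials in the time
    parameter.\<close>
  define z u where "z = [:z1, z2 - z1:]" and "u = [:u1, u2 - u1:]"
  have ends: "poly z 0 = z1" "poly z 1 = z2" "poly u 0 = u1" "poly u 1 = u2"
    by (simp_all add: z_def u_def)
  define d where "d = (c \<circ>\<^sub>p z) * u * ((s \<circ>\<^sub>p z)\<^sup>2 - (r \<circ>\<^sub>p z)\<^sup>2)"
  define X where "X = (c \<circ>\<^sub>p z) * (s \<circ>\<^sub>p z) * u\<^sup>2 + (r \<circ>\<^sub>p z) * (g \<circ>\<^sub>p z)"
  define Y where "Y = (c \<circ>\<^sub>p z) * (r \<circ>\<^sub>p z) * u\<^sup>2 + (s \<circ>\<^sub>p z) * (g \<circ>\<^sub>p z)"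
  note polys = d_def X_def Y_def poly_pcompose poly_mult poly_add poly_diff poly_power
  note 1 = generic_param[OF in_generic(1), folded u1_def]
  note 2 = generic_param[OF in_generic(2), folded u2_def]
  have d0: "poly d 0 \<noteq> 0" and d1: "poly d 1 \<noteq> 0"
    using 1(1) 2(1) by (simp_all only: polys ends not_False_eq_True)
  show "\<exists>X Y Z d a b.
    poly d a \<noteq> 0 \<and> v = (poly X a / poly d a, poly Y a / poly d a, poly Z a / poly d a) \<and>
    poly d b \<noteq> 0 \<and> w = (poly X b / poly d b, poly Y b / poly d b, poly Z b / poly d b) \<and>
    (\<forall>t. poly d t \<noteq> 0 \<longrightarrow> (poly X t / poly d t, poly Y t / poly d t, poly Z t / poly d t) \<in> surface)"
  proof (intro exI conjI allI impI)
    show "poly d 0 \<noteq> 0" "poly d 1 \<noteq> 0" by fact+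
    \<comment> \<open>The third coordinate is written as \<open>(z * d) / d\<close> to share the
      denominator \<open>d\<close>.\<close>
    show "v = (poly X 0 / poly d 0, poly Y 0 / poly d 0, poly (z * d) 0 / poly d 0)"
      using d0 1(2,3) by (simp add: v ends) (simp only: polys ends)
    show "w = (poly X 1 / poly d 1, poly Y 1 / poly d 1, poly (z * d) 1 / poly d 1)"
      using d1 2(2,3) by (simp add: w ends) (simp only: polys ends)
    show "(poly X t / poly d t, poly Y t / poly d t, poly (z * d) t / poly d t) \<in> surface"
      if "poly d t \<noteq> 0" for t
    proof -
      have "poly (z * d) t / poly d t = poly z t" using that by simp
      moreover have "form (poly X t / poly d t) (poly Y t / poly d t) (poly z t) = 0"
        using form_zero_param[of "poly z t" "poly u t"] that by (simp only: polys not_False_eq_True)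
      ultimately show ?thesis by (simp add: surface_def)
    qed
  qed
qed

end

section \<open>\<open>Q_p\<close> as a split conic bundle, and the count of components\<close>

lemma Q_poly_eq:
  assumes "p mod 3 \<noteq> 0"
  defines "n \<equiv> int (p div 3)"
  shows "Q_poly p x y z =
    cheb_S (if p mod 3 = 1 then n - 1 else n) z * (cheb_S n z * x - cheb_S (n - 1) z * y)
      * (cheb_S (n - 1) z * x - cheb_S n z * y) + cheb_S (int p - 1) z"
proof -
  have "p = 3 * (p div 3) + p mod 3" by simp
  then have "p mod 3 = 1 \<and> int p - 1 = 3 * n \<or> p mod 3 = 2 \<and> int p - 1 = 3 * n + 1"
    using assms by presburger
  then show ?thesis
    by (auto simp: Q_poly_def Let_def n_def[symmetric] algebra_simps power2_eq_square)
qed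

lemma Q_poly_conic_bundle:
  assumes "p > 3" "p mod 3 \<noteq> 0"
  defines "n \<equiv> int (p div 3)" and "X \<equiv> [:0, 1:]"
  shows "split_conic_bundle (cheb_S (if p mod 3 = 1 then n - 1 else n) X) (cheb_S n X) (cheb_S (n - 1) X) (cheb_S (int p - 1) X)"
proof
  have rel: "(cheb_S n z)\<^sup>2 + (cheb_S (n - 1) z)\<^sup>2 - z * cheb_S n z * cheb_S (n - 1) z = 1" for z :: complex
    by (rule cheb_S_consecutive)
  have X: "poly X z = z" for z by (simp add: X_def)
  show "poly (cheb_S (n - 1) X) z \<noteq> 0" if "poly (cheb_S n X) z = 0" for z
    using that rel[of z] by (auto simp: poly_cheb_S X)
  have p: "p = 3 * (p div 3) + p mod 3" by simp
  then have cases: "p mod 3 = 1 \<and> int p - 1 = 3 * n \<or> p mod 3 = 2 \<and> int p - 1 = 3 * n + 1"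
    using assms by presburger
  have triple: "cheb_S (3 * n) z = cheb_S n z ^ 3 - 3 * cheb_S n z * (cheb_S (n - 1) z)\<^sup>2 + z * cheb_S (n - 1) z ^ 3"
    "cheb_S (3 * n + 1) z = z * cheb_S n z ^ 3 - 3 * (cheb_S n z)\<^sup>2 * cheb_S (n - 1) z + cheb_S (n - 1) z ^ 3"
    for z :: complex
    unfolding n_def by (rule cheb_S_triple)+
  \<comment> \<open>Where \<open>c\<close> vanishes, tripling reduces \<open>S_{p-1}\<close> to
    \<open>s^3\<close> or \<open>r^3\<close>, which is nonzero by \<open>rel\<close>.\<close>
  show "poly (cheb_S (int p - 1) X) z \<noteq> 0"
    if "poly (cheb_S (if p mod 3 = 1 then n - 1 else n) X) z = 0" for z
    using that cases rel[of z] triple[of z] by (auto simp: poly_cheb_S X add.commute)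
  \<comment> \<open>Evaluation at 2 shows that no factor is the zero polynomial. The bound on
    \<open>n\<close> keeps the index \<open>n - 1\<close> nonnegative.\<close>
  have "n \<ge> 1" using assms by (simp add: n_def)
  have nz: "cheb_S m (2::complex) \<noteq> 0" if "m \<ge> 0" for m
    unfolding cheb_S_2[OF that] of_int_eq_0_iff using that by simp
  have "poly (cheb_S (if p mod 3 = 1 then n - 1 else n) X) 2 \<noteq> 0"
    using nz \<open>n \<ge> 1\<close> by (simp add: poly_cheb_S X)
  moreover have "poly (cheb_S (int p - 1) X) 2 \<noteq> 0"
    using assms(1) nz by (simp add: poly_cheb_S X)
  moreover have "poly ((cheb_S n X)\<^sup>2 - (cheb_S (n - 1) X)\<^sup>2) 2 = of_int (2 * n + 1)"
    using \<open>n \<ge> 1\<close> by (simp add: poly_cheb_S X cheb_S_2) (simp add: power2_eq_square algebra_simps)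
  moreover have "2 * n + 1 \<noteq> 0" using \<open>n \<ge> 1\<close> by simp
  then have "of_int (2 * n + 1) \<noteq> (0::complex)" by (simp only: of_int_eq_0_iff not_False_eq_True)
  ultimately show "cheb_S (if p mod 3 = 1 then n - 1 else n) X * cheb_S (int p - 1) X *
      ((cheb_S n X)\<^sup>2 - (cheb_S (n - 1) X)\<^sup>2) \<noteq> 0"
    by (metis mult_eq_0_iff poly_0)
qed

theorem theorem2:
  fixes p :: nat
  assumes "p > 3" and "coprime p 3"
  shows "link_character_variety p 3 =
           {(x, y, z). (x\<^sup>2 + y\<^sup>2 + z\<^sup>2 - x * y * z - 4) * Q_poly p x y z = 0}
         \<and> card (irreducible_components (link_character_variety p 3)) = 2"
proof
  show var: "link_character_variety p 3 =
      {(x, y, z). (x\<^sup>2 + y\<^sup>2 + z\<^sup>2 - x * y * z - 4) * Q_poly p x y z = 0}"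
    using assms(2) by (rule link_character_variety_3)
  have "\<not> 3 dvd p" using assms(2) by (auto simp: coprime_absorb_right)
  then have p3: "p mod 3 \<noteq> 0" by (simp add: dvd_eq_mod_eq_0)
  define V1 :: "(complex \<times> complex \<times> complex) set"
    where "V1 = {(x, y, z). x\<^sup>2 + y\<^sup>2 + z\<^sup>2 - x * y * z - 4 = 0}"
  define V2 where "V2 = {(x, y, z). Q_poly p x y z = 0}"
  have Un: "link_character_variety p 3 = V1 \<union> V2"
    unfolding var V1_def V2_def by auto
  \<comment> \<open>Points on the \<open>z\<close>-axis separate the components. The cubic restricts
    there to \<open>z^2 - 4\<close> and \<open>Q_p\<close> to \<open>S_{p-1}(z)\<close>, with value
    \<open>p\<close> at 2.\<close>
  have Q00: "Q_poly p 0 0 z = cheb_S (int p - 1) z" for z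
    by (simp add: Q_poly_eq[OF p3])
  have in_V1: "(0, 0, 2) \<in> V1" "(0, 0, 2) \<notin> V2"
    using assms(1) by (simp_all add: V1_def V2_def Q00 cheb_S_2)
  \<comment> \<open>This angle makes \<open>2 cos \<theta>\<close> a zero of \<open>S_{p-1}\<close>,
    because \<open>sin (p \<theta>) = 0\<close> while \<open>sin \<theta> > 0\<close>.\<close>
  define \<theta> where "\<theta> = pi / real p"
  have "0 < \<theta>" "\<theta> < pi" using assms(1) by (simp_all add: \<theta>_def field_simps)
  then have sin: "sin \<theta> > 0" by (rule sin_gt_zero)
  define \<zeta> where "\<zeta> = complex_of_real (2 * cos \<theta>)"
  have "cheb_S (int (p - 1)) \<zeta> * complex_of_real (sin \<theta>) = complex_of_real (sin (real (p - 1 + 1) * \<theta>))"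
    unfolding \<zeta>_def by (rule cheb_S_cos)
  also have "real (p - 1 + 1) * \<theta> = pi" using assms(1) by (simp add: \<theta>_def)
  finally have "cheb_S (int p - 1) \<zeta> = 0" using sin assms(1) by (simp add: of_nat_diff)
  \<comment> \<open>The cubic takes the value \<open>- 4 sin^2 \<theta>\<close> at
    \<open>(0, 0, \<zeta>)\<close>, so this point of \<open>V2\<close> lies off \<open>V1\<close>.
    It also shows that \<open>V2\<close> is nonempty.\<close>
  moreover have "\<zeta>\<^sup>2 - 4 = complex_of_real (- 4 * (sin \<theta>)\<^sup>2)"
    by (simp add: \<zeta>_def power_mult_distrib cos_squared_eq algebra_simps flip: of_real_power)
  then have "\<zeta>\<^sup>2 - 4 \<noteq> 0" using sin by simp
  ultimately have in_V2: "(0, 0, \<zeta>) \<in> V2" "(0, 0, \<zeta>) \<notin> V1"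
    by (simp_all add: V1_def V2_def Q00)
  have irr1: "irreducible_set V1"
    unfolding V1_def by (rule irreducible_Cayley_cubic)
  interpret split_conic_bundle "cheb_S (if p mod 3 = 1 then int (p div 3) - 1 else int (p div 3)) [:0, 1:]"
    "cheb_S (int (p div 3)) [:0, 1:]" "cheb_S (int (p div 3) - 1) [:0, 1:]" "cheb_S (int p - 1) [:0, 1:]"
    using assms(1) p3 by (rule Q_poly_conic_bundle)
  have "surface = V2"
    unfolding surface_def form_def V2_def Q_poly_eq[OF p3] by (simp add: poly_cheb_S)
  then have irr2: "irreducible_set V2"
    using irreducible_surface in_V2 by auto
  have "irreducible_components (link_character_variety p 3) = {V1, V2}"
    unfolding Un using irr1 irr2 in_V1 in_V2 by (intro irreducible_components_Un) auto
  moreover have "V1 \<noteq> V2" using in_V1 by auto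
  ultimately show "card (irreducible_components (link_character_variety p 3)) = 2" by simp
qed

end
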